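(* Let $\Omega\subset\mathbb C^n$ be a bounded open set and $1<q\le\infty$. Suppose that for every $\zeta\in\partial\Omega$ there exists $f_\zeta\in\bigcap_{p<q}\mathcal{O}L^p(\Omega)$ such that $f_\zeta\notin\mathcal{O}L^q(B(\zeta,\varepsilon)\cap\Omega)$ for every $\varepsilon>0$ and $\lim_{z\to\zeta,\,z\in\Omega}f_\zeta(z)=\infty$. Then the set $$\Big\{g\in\bigcap_{p<q}\mathcal{O}L^p(\Omega): g\text{ is totally unbounded in }\Omega\text{ and } g\notin\mathcal{O}L^q(B(\zeta,\varepsilon)\cap\Omega)\ \forall\zeta\in\partial\Omega,\ \forall\varepsilon>0\Big\}$$ is dense and $G_\delta$ in $\bigcap_{p<q}\mathcal{O}L^p(\Omega)$.
   Context: For an open bounded set $D$ and $p\ge1$, $\mathcal{O}L^p(D)$ is the space of holomorphic $f$ on $D$ with $\int_D|f|^p\,dv<\infty$; $\mathcal{O}L^\infty(D)$ is the space of bounded holomorphic functions on $D$. "$g\notin\mathcal{O}L^q(B(\zeta,\varepsilon)\cap\Omega)$" means the restriction of $g$ to $B(\zeta,\varepsilon)\cap\Omega$ is not in that space. For $1<q\le\infty$, $\bigcap_{p<q}\mathcal{O}L^p(\Omega)$ carries the complete metric $d(f,g)=\sum_j2^{-j}\frac{\|f-g\|_{p_j}}{1+\|f-g\|_{p_j}}$ with $1<p_1<p_2<\dots$, $p_j\to q$; convergence means $\|f_k-f\|_p\to0$ for all $p<q$. A holomorphic $f$ is totally unbounded in $\Omega$ if for every $w\in\partial\Omega$, $\delta>0$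 and every connected component $E$ of $B(w,\delta)\cap\Omega$, $\sup_E|f|=\infty$. *)

theory Defs
  imports "HOL-Analysis.Analysis"
begin

definition holo_on :: "(complex^'n \<Rightarrow> complex) \<Rightarrow> (complex^'n) set \<Rightarrow> bool" where
  "holo_on f D \<longleftrightarrow> (\<forall>z\<in>D. \<exists>L. (f has_derivative L) (at z) \<and> (\<forall>c v. L (c *s v) = c * L v))"

definition Lp_integral :: "real \<Rightarrow> (complex^'n) set \<Rightarrow> (complex^'n \<Rightarrow> complex) \<Rightarrow> ennreal" where
  "Lp_integral p D f = (\<integral>\<^sup>+ z\<in>D. ennreal (norm (f z) powr p) \<partial>lborel)"

definition OL :: "real \<Rightarrow> (complex^'n) set \<Rightarrow> (complex^'n \<Rightarrow> complex) \<Rightarrow> bool" where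
  "OL p D f \<longleftrightarrow> holo_on f D \<and> Lp_integral p D f < \<infinity>"

definition OL_inf :: "(complex^'n) set \<Rightarrow> (complex^'n \<Rightarrow> complex) \<Rightarrow> bool" where
  "OL_inf D f \<longleftrightarrow> holo_on f D \<and> bounded (f ` D)"

definition OLq :: "ereal \<Rightarrow> (complex^'n) set \<Rightarrow> (complex^'n \<Rightarrow> complex) \<Rightarrow> bool" where
  "OLq q D f \<longleftrightarrow> (if q = \<infinity> then OL_inf D f else OL (real_of_ereal q) D f)"

definition OL_below :: "ereal \<Rightarrow> (complex^'n) set \<Rightarrow> (complex^'n \<Rightarrow> complex) \<Rightarrow> bool" where
  "OL_below q D f \<longleftrightarrow> (\<forall>p::real. 1 \<le> p \<and> ereal p < q \<longrightarrow> OL p D f)"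

text \<open>The space (intersection over p<q of OL^p(Omega)); functions are considered on Omega
  only, normalised to be 0 outside Omega so that elements are identified with their
  restrictions to Omega.\<close>
definition OL_space :: "ereal \<Rightarrow> (complex^'n) set \<Rightarrow> (complex^'n \<Rightarrow> complex) set" where
  "OL_space q \<Omega> = {f. OL_below q \<Omega> f \<and> (\<forall>z. z \<notin> \<Omega> \<longrightarrow> f z = 0)}"

definition Lp_norm :: "real \<Rightarrow> (complex^'n) set \<Rightarrow> (complex^'n \<Rightarrow> complex) \<Rightarrow> real" where
  "Lp_norm p D f = enn2real (Lp_integral p D f) powr (1 / p)"

text \<open>The metric d(f,g) = sum_j 2^(-j) ||f-g||_{p_j} / (1 + ||f-g||_{p_j}), j = 1,2,...
  (here the sequence pj is indexed from 0, pj j playing the role of p_(j+1)).\<close>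
definition OL_dist :: "(nat \<Rightarrow> real) \<Rightarrow> (complex^'n) set
    \<Rightarrow> (complex^'n \<Rightarrow> complex) \<Rightarrow> (complex^'n \<Rightarrow> complex) \<Rightarrow> real" where
  "OL_dist pj \<Omega> f g = (\<Sum>j. (1/2) ^ (Suc j) *
      (Lp_norm (pj j) \<Omega> (\<lambda>z. f z - g z) / (1 + Lp_norm (pj j) \<Omega> (\<lambda>z. f z - g z))))"

definition totally_unbounded :: "(complex^'n \<Rightarrow> complex) \<Rightarrow> (complex^'n) set \<Rightarrow> bool" where
  "totally_unbounded f \<Omega> \<longleftrightarrow>
     (\<forall>w\<in>frontier \<Omega>. \<forall>\<delta>>0. \<forall>E\<in>components (ball w \<delta> \<inter> \<Omega>). \<not> bounded (f ` E))"

end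

theory Submission
  imports Defs "HOL-Complex_Analysis.Cauchy_Integral_Formula"
begin

text \<open>Total unboundedness and failure of local q-integrability at the boundary are equivalent to
  countably many conditions "\<open>g\<close> is not in the linear subspace \<open>V\<^sub>i\<close>", where the \<open>V\<^sub>i\<close> are given by
  boundedness or q-integrability on components of \<open>B \<inter> \<Omega>\<close>, resp. on \<open>B \<inter> \<Omega>\<close>, and \<open>B\<close> runs through the
  members of a countable base of balls that meet the boundary. Each \<open>V\<^sub>i\<close> is a countable union of sets
  that are closed under almost everywhere convergence (Fatou's lemma and continuity), hence closed in
  the metric; this gives the \<open>G\<^sub>\<delta>\<close> property. The given functions \<open>f\<^sub>\<zeta>\<close> show that each \<open>V\<^sub>i\<close> misses
  some \<open>f\<^sub>i\<close> in the space. After rescaling, \<open>\<Sum>\<^sub>i a\<^sub>i f\<^sub>i\<close> converges for every bounded sequence \<open>a\<close>,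
  locally uniformly and in all the norms, and for fixed \<open>g\<close> the set of those \<open>a\<close> for which
  \<open>g + \<Sum>\<^sub>i a\<^sub>i f\<^sub>i\<close> lies in some \<open>V\<^sub>i\<close> is meagre in the space of bounded sequences. Hence \<open>a\<close> can be
  chosen outside of it with arbitrarily small norm, which gives density.\<close>

section \<open>Holomorphic functions of several variables\<close>

lemma holo_onE:
  assumes "holo_on f D" "z \<in> D"
  obtains L where "(f has_derivative L) (at z)" "\<And>c v. L (c *s v) = c * L v"
  using assms unfolding holo_on_def by blast

lemma holo_on_subset: "holo_on f D \<Longrightarrow> E \<subseteq> D \<Longrightarrow> holo_on f E"
  unfolding holo_on_def by blast

lemma holo_on_imp_continuous_on: "holo_on f D \<Longrightarrow> continuous_on D f"
  by (meson continuous_at_imp_continuous_on has_derivative_continuous holo_onE)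

lemma holo_on_const: "holo_on (\<lambda>z. c) D"
  unfolding holo_on_def using has_derivative_const by fastforce

lemma holo_on_add:
  assumes "holo_on f D" "holo_on g D"
  shows "holo_on (\<lambda>z. f z + g z) D"
  unfolding holo_on_def
proof
  fix z assume z: "z \<in> D"
  obtain L M where "(f has_derivative L) (at z)" "\<And>c v. L (c *s v) = c * L v"
    and "(g has_derivative M) (at z)" "\<And>c v. M (c *s v) = c * M v"
    using holo_onE[OF assms(1) z] holo_onE[OF assms(2) z] by metis
  then show "\<exists>L. ((\<lambda>z. f z + g z) has_derivative L) (at z) \<and> (\<forall>c v. L (c *s v) = c * L v)"
    by (intro exI[of _ "\<lambda>v. L v + M v"] conjI has_derivative_add) (simp_all add: algebra_simps)
qed

lemma holo_on_cmult:
  assumes "holo_on f D"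
  shows "holo_on (\<lambda>z. a * f z) D"
  unfolding holo_on_def
proof
  fix z assume z: "z \<in> D"
  obtain L where "(f has_derivative L) (at z)" "\<And>c v. L (c *s v) = c * L v"
    using holo_onE[OF assms z] by metis
  then show "\<exists>L. ((\<lambda>z. a * f z) has_derivative L) (at z) \<and> (\<forall>c v. L (c *s v) = c * L v)"
    by (intro exI[of _ "\<lambda>v. a * L v"] conjI has_derivative_mult_right) (simp_all add: algebra_simps)
qed

lemma holo_on_cong:
  assumes "open D" "holo_on f D" "\<And>z. z \<in> D \<Longrightarrow> f z = g z"
  shows "holo_on g D"
  unfolding holo_on_def
proof
  fix z assume z: "z \<in> D"
  obtain L where L: "(f has_derivative L) (at z)" "\<And>c v. L (c *s v) = c * L v"
    using holo_onE[OF assms(2) z] by metis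
  from L(1) have "(g has_derivative L) (at z)"
    by (rule has_derivative_transform_within_open[OF _ assms(1) z]) (rule assms(3))
  with L(2) show "\<exists>L. (g has_derivative L) (at z) \<and> (\<forall>c v. L (c *s v) = c * L v)"
    by blast
qed

section \<open>Cauchy estimates and termwise differentiation of series\<close>

lemma norm_smult_complex_vec: "norm (c *s (v :: complex^'n)) = norm c * norm v"
  by (simp add: norm_vec_def L2_set_def norm_mult power_mult_distrib sum_distrib_left [symmetric]
      real_sqrt_mult)

text \<open>Cauchy's inequality in one variable, applied to \<open>f\<close> on the complex line
  through \<open>z\<close> in the direction \<open>h\<close>.\<close>

lemma holo_derivative_bound:
  fixes f :: "complex^'n \<Rightarrow> complex"
  assumes holo: "holo_on f (cball z r)" and r: "0 < r"
    and B: "\<And>w. w \<in> cball z r \<Longrightarrow> norm (f w) \<le> B"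
    and L: "(f has_derivative L) (at z)" "\<And>c v. L (c *s v) = c * L v"
  shows "norm (L h) \<le> B / r * norm h"
proof (cases "h = 0")
  case True
  then show ?thesis using L(2)[of 0 0] by simp
next
  case False
  \<comment> \<open>Unit vector on the complex line of \<open>h\<close>, so that the disc of radius
    \<open>r\<close> is mapped into \<open>cball z r\<close> by
    \<open>w \<mapsto> z + w *s u\<close>; the estimate for \<open>h\<close> follows from the one
    for \<open>u\<close> by homogeneity.\<close>
  define u where "u = (of_real (1 / norm h) :: complex) *s h"
  have u: "norm u = 1" using False by (simp add: u_def norm_smult_complex_vec norm_divide)
  define \<phi> where "\<phi> = (\<lambda>w::complex. f (z + w *s u))"
  have in_ball: "z + w *s u \<in> cball z r" if "norm w \<le> r" for w
    using that by (simp add: dist_norm norm_smult_complex_vec u)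
  have line: "((\<lambda>w. z + w *s u) has_derivative (\<lambda>w. w *s u)) (at w)" for w
  proof -
    have "bounded_linear (\<lambda>w::complex. w *s u)"
    proof (rule bounded_linear_intro[where K=1])
      show "(r *\<^sub>R w) *s u = r *\<^sub>R (w *s u)" for r w
        by (simp add: vec_eq_iff)
    qed (simp_all add: vec_eq_iff algebra_simps norm_smult_complex_vec u)
    then show ?thesis
      by (auto intro!: derivative_eq_intros bounded_linear_imp_has_derivative)
  qed
  \<comment> \<open>Complex linearity of \<open>M\<close> turns the real chain rule into a complex
    derivative of \<open>\<phi>\<close> with value \<open>M u\<close>.\<close>
  have deriv: "(\<phi> has_field_derivative M u) (at w)"
    if "(f has_derivative M) (at (z + w *s u))" "\<And>c v. M (c *s v) = c * M v" for M w
  proof -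
    have "(*) (M u) = (\<lambda>w. M (w *s u))" by (simp add: that(2) fun_eq_iff)
    then show ?thesis
      using has_derivative_compose[OF line that(1)]
      by (simp add: \<phi>_def has_field_derivative_def)
  qed
  have diff: "\<exists>d. (\<phi> has_field_derivative d) (at w)" if "norm w \<le> r" for w
    using holo_onE[OF holo in_ball[OF that]] deriv by metis
  have "\<phi> holomorphic_on ball 0 r"
    unfolding holomorphic_on_def field_differentiable_def
  proof
    fix w :: complex assume "w \<in> ball 0 r"
    then have "norm w \<le> r" by simp
    then show "\<exists>d. (\<phi> has_field_derivative d) (at w within ball 0 r)"
      using diff has_field_derivative_at_within by blast
  qed
  moreover have "continuous_on (cball 0 r) \<phi>"
  proof (intro continuous_at_imp_continuous_on ballI)
    fix w :: complex assume "w \<in> cball 0 r"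
    then show "isCont \<phi> w" using diff[of w] DERIV_isCont by auto
  qed
  ultimately have "norm ((deriv ^^ 1) \<phi> 0) \<le> fact 1 * B / r ^ 1"
    using r B in_ball by (intro Cauchy_inequality) (auto simp: \<phi>_def)
  moreover have "deriv \<phi> 0 = L u"
    using deriv[of L 0] L by (simp add: DERIV_imp_deriv)
  ultimately have "norm (L u) \<le> B / r" by simp
  moreover have "L h = of_real (norm h) * L u"
    unfolding u_def L(2) using False by simp
  ultimately show ?thesis
    using mult_right_mono[of "norm (L u)" "B / r" "norm h"] by (simp add: norm_mult mult.commute)
qed

text \<open>Weierstrass' theorem: by the Cauchy estimates a summable majorant for the functions is,
  up to a constant factor, one for the derivatives on a smaller ball. Hence the series may be
  differentiated term by term, and complex linearity passes to the sum.\<close>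

lemma holo_on_suminf:
  fixes F :: "nat \<Rightarrow> complex^'n \<Rightarrow> complex"
  assumes "open D" and holo: "\<And>k. holo_on (F k) D"
    and bound: "\<And>K. compact K \<Longrightarrow> K \<subseteq> D \<Longrightarrow>
      \<exists>M. summable M \<and> (\<forall>\<^sub>F k in sequentially. \<forall>z\<in>K. norm (F k z) \<le> M k)"
  shows "holo_on (\<lambda>z. \<Sum>k. F k z) D"
  unfolding holo_on_def
proof
  fix z0 assume z0: "z0 \<in> D"
  obtain e where e: "0 < e" "cball z0 e \<subseteq> D"
    using \<open>open D\<close> z0 open_contains_cball by blast
  define r where "r = e / 2"
  have r: "r > 0" using e by (simp add: r_def)
  obtain M where M: "summable M" "\<forall>\<^sub>F k in sequentially. \<forall>z\<in>cball z0 e. norm (F k z) \<le> M k"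
    using bound[of "cball z0 e"] e by auto
  then obtain N where N: "\<And>k z. k \<ge> N \<Longrightarrow> z \<in> cball z0 e \<Longrightarrow> norm (F k z) \<le> M k"
    unfolding eventually_sequentially by blast
  have "\<forall>k z. \<exists>L. z \<in> D \<longrightarrow> (F k has_derivative L) (at z) \<and> (\<forall>c v. L (c *s v) = c * L v)"
    using holo unfolding holo_on_def by blast
  then obtain L where L: "\<And>k z. z \<in> D \<Longrightarrow> (F k has_derivative L k z) (at z)"
      "\<And>k z c v. z \<in> D \<Longrightarrow> L k z (c *s v) = c * L k z v"
    by metis
  define S where "S = ball z0 r"
  have SD: "S \<subseteq> D" and S_e: "S \<subseteq> cball z0 e" using e by (auto simp: S_def r_def)
  have sub: "cball z r \<subseteq> cball z0 e" if "z \<in> S" for z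
  proof
    fix w assume "w \<in> cball z r"
    then show "w \<in> cball z0 e"
      using that dist_triangle[of z0 w z] by (simp add: S_def r_def)
  qed
  have Lb: "norm (L k z h) \<le> M k / r * norm h" if "k \<ge> N" "z \<in> S" for k z h
  proof (rule holo_derivative_bound)
    show "holo_on (F k) (cball z r)"
      using holo sub[OF that(2)] e by (meson holo_on_subset order_trans)
  qed (use that sub[OF that(2)] N r L SD in auto)
  have sumL: "summable (\<lambda>k. L k z h)" if "z \<in> S" for z h
    by (rule summable_comparison_test'[where N=N and g="\<lambda>k. M k / r * norm h"])
       (use M Lb that in \<open>auto intro: summable_mult2 summable_divide\<close>)
  define G where "G = (\<lambda>z h. \<Sum>k. L k z h)"
  \<comment> \<open>Uniform convergence of the derivatives in operator norm, the hypothesis of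
    termwise differentiation; the remainder is at most the tail of \<open>M\<close> divided by
    \<open>r\<close>.\<close>
  have unif: "\<forall>\<^sub>F n in sequentially. \<forall>x\<in>S. \<forall>h. norm (sum (\<lambda>i. L i x h) {..<n} - G x h) \<le> d * norm h"
    if "d > 0" for d
  proof -
    have "(\<lambda>n. \<Sum>k. M (k + n)) \<longlonglongrightarrow> 0"
      using M(1) by (rule suminf_exist_split2)
    then have "\<forall>\<^sub>F n in sequentially. (\<Sum>k. M (k + n)) < d * r"
      by (rule order_tendstoD) (use that r in simp)
    then show ?thesis
      using eventually_ge_at_top[of N]
    proof eventually_elim
      fix n assume n: "(\<Sum>k. M (k + n)) < d * r" "N \<le> n"
      show "\<forall>x\<in>S. \<forall>h. norm (sum (\<lambda>i. L i x h) {..<n} - G x h) \<le> d * norm h"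
      proof (intro ballI allI)
        fix x h assume x: "x \<in> S"
        have sm: "summable (\<lambda>k. M (k + n))" using M(1) by (subst summable_iff_shift)
        have "norm (sum (\<lambda>i. L i x h) {..<n} - G x h) = norm (\<Sum>k. L (k + n) x h)"
          unfolding G_def using suminf_split_initial_segment[OF sumL[OF x, of h], of n]
          by (simp add: norm_minus_commute)
        also have "\<dots> \<le> (\<Sum>k. M (k + n) / r * norm h)"
          by (rule norm_suminf_le) (use sm Lb x n in \<open>auto intro: summable_mult2 summable_divide\<close>)
        also have "\<dots> = (\<Sum>k. M (k + n)) / r * norm h"
          by (simp only: suminf_mult2[OF summable_divide[OF sm], symmetric] suminf_divide[OF sm])
        also have "\<dots> \<le> d * norm h"
          using n r by (intro mult_right_mono) (auto simp: field_simps)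
        finally show "norm (sum (\<lambda>i. L i x h) {..<n} - G x h) \<le> d * norm h" .
      qed
    qed
  qed
  have z0S: "z0 \<in> S" using r by (simp add: S_def)
  have "summable (\<lambda>k. F k z0)"
    using N S_e z0S by (intro summable_comparison_test'[OF M(1), of N]) blast
  moreover have "(F k has_derivative L k x) (at x within S)" if "x \<in> S" for k x
    using L(1) SD that by (blast intro: has_derivative_at_withinI)
  ultimately have "\<exists>g. \<forall>x\<in>S. (\<lambda>n. F n x) sums g x \<and> (g has_derivative G x) (at x within S)"
    by (intro has_derivative_series[OF _ _ unif z0S summable_sums]) (simp_all add: S_def)
  then obtain g where g: "\<And>x. x \<in> S \<Longrightarrow> (\<lambda>n. F n x) sums g x"
      "\<And>x. x \<in> S \<Longrightarrow> (g has_derivative G x) (at x within S)"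
    by blast
  have "(g has_derivative G z0) (at z0)"
    using g(2)[OF z0S] z0S by (subst (asm) at_within_open) (simp_all add: S_def)
  then have "((\<lambda>z. \<Sum>k. F k z) has_derivative G z0) (at z0)"
    by (rule has_derivative_transform_within_open[of _ _ _ _ S])
       (use g(1) z0S in \<open>auto simp: S_def sums_iff\<close>)
  moreover have "G z0 (c *s v) = c * G z0 v" for c v
    unfolding G_def using z0 sumL[OF z0S] by (simp add: L(2) suminf_mult)
  ultimately show "\<exists>L. ((\<lambda>z. \<Sum>k. F k z) has_derivative L) (at z0) \<and> (\<forall>c v. L (c *s v) = c * L v)"
    by blast
qed

section \<open>The Lp norms\<close>

lemma Lp_integral_eq: "Lp_integral p D f = (\<integral>\<^sup>+ z. ennreal (norm (f z) powr p) * indicator D z \<partial>lborel)"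
  by (simp add: Lp_integral_def)

lemma Lp_integral_mono_set: "D \<subseteq> E \<Longrightarrow> Lp_integral p D f \<le> Lp_integral p E f"
  unfolding Lp_integral_eq by (intro nn_integral_mono) (auto split: split_indicator)

lemma Lp_integral_cong: "(\<And>z. z \<in> D \<Longrightarrow> f z = g z) \<Longrightarrow> Lp_integral p D f = Lp_integral p D g"
  unfolding Lp_integral_eq by (intro nn_integral_cong) (auto split: split_indicator)

lemma Lp_integral_cmult:
  assumes [measurable]: "f \<in> borel_measurable borel" "D \<in> sets borel"
  shows "Lp_integral p D (\<lambda>z. c * f z) = ennreal (norm c powr p) * Lp_integral p D f"
  unfolding Lp_integral_eq
  by (subst nn_integral_cmult[symmetric])
     (auto simp: norm_mult powr_mult ennreal_mult' mult.assoc)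

section \<open>Minkowski's inequality and limits under the integral\<close>

lemma powr_convex_comb_le:
  fixes x y :: real
  assumes "0 \<le> x" "0 \<le> y" "0 \<le> s" "0 \<le> t" "s + t = 1" "1 \<le> p"
  shows "(s * x + t * y) powr p \<le> s * x powr p + t * y powr p"
proof -
  \<comment> \<open>If one of the two points is 0, the inequality reduces to
    \<open>u powr p \<le> u\<close> on the unit interval; convexity handles two positive
    points.\<close>
  have scale: "(u * w) powr p \<le> u * w powr p" if "0 \<le> u" "u \<le> 1" "0 \<le> w" for u w :: real
  proof (cases "u = 0")
    case False
    have "u powr p \<le> u powr 1"
      using that False \<open>1 \<le> p\<close> by (intro powr_mono') auto
    then show ?thesis
      using that by (simp add: powr_mult mult_right_mono)
  qed simp
  consider "x = 0" | "y = 0" | "0 < x" "0 < y" using assms by linarith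
  then show ?thesis
  proof cases
    case 3
    then show ?thesis
      using convex_onD[OF powr_convex[OF \<open>1 \<le> p\<close>], of t x y] assms by (simp add: eq_diff_eq[symmetric])
  qed (use scale assms in auto)
qed

text \<open>Minkowski's inequality in terms of bounds: the sum of the absolute values divided by
  \<open>\<alpha> + \<beta>\<close> is a convex combination of \<open>norm (f z) / \<alpha>\<close>
  and \<open>norm (g z) / \<beta>\<close>, and the p-th power is convex. Positive bounds make the
  divisions legitimate.\<close>

lemma Lp_integral_add_le:
  fixes f g :: "complex^'n \<Rightarrow> complex"
  assumes [measurable]: "f \<in> borel_measurable borel" "g \<in> borel_measurable borel" "D \<in> sets borel"
    and "1 \<le> p" "0 < \<alpha>" "0 < \<beta>"
    and f: "Lp_integral p D f \<le> ennreal (\<alpha> powr p)"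
    and g: "Lp_integral p D g \<le> ennreal (\<beta> powr p)"
  shows "Lp_integral p D (\<lambda>z. f z + g z) \<le> ennreal ((\<alpha> + \<beta>) powr p)"
proof -
  define s t where "s = \<alpha> / (\<alpha> + \<beta>)" and "t = \<beta> / (\<alpha> + \<beta>)"
  have st: "0 \<le> s" "0 \<le> t" "s + t = 1"
    using assms by (auto simp: s_def t_def add_divide_distrib[symmetric])
  \<comment> \<open>Chosen so that after integration the two terms contribute at most
    \<open>s\<close> and \<open>t\<close> times \<open>(\<alpha> + \<beta>) powr p\<close>.\<close>
  define A B where "A = (\<alpha> + \<beta>) powr p * s / \<alpha> powr p" and "B = (\<alpha> + \<beta>) powr p * t / \<beta> powr p"
  have AB: "0 \<le> A" "0 \<le> B" using st by (auto simp: A_def B_def)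
  have pw: "norm (f z + g z) powr p \<le> A * norm (f z) powr p + B * norm (g z) powr p" for z
  proof -
    have "norm (f z + g z) powr p \<le> (norm (f z) + norm (g z)) powr p"
      using \<open>1 \<le> p\<close> by (intro powr_mono2 norm_triangle_ineq) auto
    also have "norm (f z) + norm (g z) = (\<alpha> + \<beta>) * (s * (norm (f z) / \<alpha>) + t * (norm (g z) / \<beta>))"
      using assms by (simp add: s_def t_def distrib_left add_pos_pos less_imp_neq[symmetric])
    also have "\<dots> powr p = (\<alpha> + \<beta>) powr p * (s * (norm (f z) / \<alpha>) + t * (norm (g z) / \<beta>)) powr p"
      using assms st by (intro powr_mult)
    also have "\<dots> \<le> (\<alpha> + \<beta>) powr p * (s * (norm (f z) / \<alpha>) powr p + t * (norm (g z) / \<beta>) powr p)"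
      using assms st by (intro mult_left_mono powr_convex_comb_le) auto
    also have "\<dots> = A * norm (f z) powr p + B * norm (g z) powr p"
      using assms by (simp add: A_def B_def powr_divide algebra_simps)
    finally show ?thesis .
  qed
  have "Lp_integral p D (\<lambda>z. f z + g z) \<le>
      (\<integral>\<^sup>+ z. ennreal A * (ennreal (norm (f z) powr p) * indicator D z)
        + ennreal B * (ennreal (norm (g z) powr p) * indicator D z) \<partial>lborel)"
    unfolding Lp_integral_eq
    using pw AB by (intro nn_integral_mono)
      (auto simp: ennreal_mult[symmetric] ennreal_plus[symmetric] simp del: ennreal_plus
        split: split_indicator)
  also have "\<dots> = ennreal A * Lp_integral p D f + ennreal B * Lp_integral p D g"
    unfolding Lp_integral_eq by (simp add: nn_integral_add nn_integral_cmult)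
  also have "\<dots> \<le> ennreal A * ennreal (\<alpha> powr p) + ennreal B * ennreal (\<beta> powr p)"
    by (intro add_mono mult_left_mono f g) auto
  also have "\<dots> = ennreal (A * \<alpha> powr p + B * \<beta> powr p)"
    using AB by (simp add: ennreal_mult)
  also have "A * \<alpha> powr p + B * \<beta> powr p = (\<alpha> + \<beta>) powr p * (s + t)"
    using assms by (simp add: A_def B_def algebra_simps)
  finally show ?thesis using st by simp
qed

lemma Lp_norm_nonneg [simp]: "0 \<le> Lp_norm p D f"
  by (simp add: Lp_norm_def)

lemma Lp_integral_eq_Lp_norm:
  assumes "Lp_integral p D f < \<infinity>" "0 < p"
  shows "Lp_integral p D f = ennreal (Lp_norm p D f powr p)"
  using assms by (simp add: Lp_norm_def powr_powr)

lemma Lp_norm_le: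
  assumes "Lp_integral p D f \<le> ennreal (\<alpha> powr p)" "0 < p" "0 \<le> \<alpha>"
  shows "Lp_norm p D f \<le> \<alpha>"
proof -
  have "enn2real (Lp_integral p D f) \<le> \<alpha> powr p"
    using assms by (simp add: enn2real_leI)
  then have "Lp_norm p D f \<le> (\<alpha> powr p) powr (1 / p)"
    unfolding Lp_norm_def using assms by (intro powr_mono2) auto
  then show ?thesis using assms by (simp add: powr_powr)
qed

lemma Lp_norm_zero: "p > 0 \<Longrightarrow> Lp_norm p D (\<lambda>z. 0) = 0"
  by (simp add: Lp_norm_def Lp_integral_def)

lemma Lp_norm_cmult:
  assumes "f \<in> borel_measurable borel" "D \<in> sets borel" "0 < p"
  shows "Lp_norm p D (\<lambda>z. c * f z) = norm c * Lp_norm p D f"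
  using assms by (simp add: Lp_norm_def Lp_integral_cmult enn2real_mult powr_mult powr_powr)

lemma Lp_integral_add_finite:
  fixes f g :: "complex^'n \<Rightarrow> complex"
  assumes "f \<in> borel_measurable borel" "g \<in> borel_measurable borel" "D \<in> sets borel" "1 \<le> p"
    and "Lp_integral p D f < \<infinity>" "Lp_integral p D g < \<infinity>"
  shows "Lp_integral p D (\<lambda>z. f z + g z) < \<infinity>"
proof -
  \<comment> \<open>The added 1 makes the bound positive even when the norm is 0.\<close>
  have "Lp_integral p D h \<le> ennreal ((Lp_norm p D h + 1) powr p)" if "Lp_integral p D h < \<infinity>" for h
    using that assms(4) by (subst Lp_integral_eq_Lp_norm) (auto intro!: ennreal_leI powr_mono2)
  then have "Lp_integral p D (\<lambda>z. f z + g z)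
      \<le> ennreal ((Lp_norm p D f + 1 + (Lp_norm p D g + 1)) powr p)"
    using assms by (intro Lp_integral_add_le) (auto intro: add_nonneg_pos)
  then show ?thesis
    by (simp add: le_less_trans)
qed

lemma Lp_norm_triangle:
  fixes f g :: "complex^'n \<Rightarrow> complex"
  assumes "f \<in> borel_measurable borel" "g \<in> borel_measurable borel" "D \<in> sets borel" "1 \<le> p"
    and "Lp_integral p D f < \<infinity>" "Lp_integral p D g < \<infinity>"
  shows "Lp_norm p D (\<lambda>z. f z + g z) \<le> Lp_norm p D f + Lp_norm p D g"
proof (rule field_le_epsilon)
  fix e :: real assume e: "0 < e"
  \<comment> \<open>Again a positive bound is required, here with slack \<open>e/2\<close> for each
    function, which vanishes as \<open>e\<close> tends to 0.\<close>
  have "Lp_integral p D h \<le> ennreal ((Lp_norm p D h + e/2) powr p)" if "Lp_integral p D h < \<infinity>" for h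
    using that assms(4) e by (subst Lp_integral_eq_Lp_norm) (auto intro!: ennreal_leI powr_mono2)
  then have "Lp_integral p D (\<lambda>z. f z + g z)
      \<le> ennreal ((Lp_norm p D f + e/2 + (Lp_norm p D g + e/2)) powr p)"
    using assms e by (intro Lp_integral_add_le) (auto intro: add_nonneg_pos)
  then have "Lp_norm p D (\<lambda>z. f z + g z) \<le> Lp_norm p D f + e/2 + (Lp_norm p D g + e/2)"
    using assms e by (intro Lp_norm_le) auto
  then show "Lp_norm p D (\<lambda>z. f z + g z) \<le> Lp_norm p D f + Lp_norm p D g + e" by simp
qed

text \<open>Fatou's lemma. It shows that q-integrability with a fixed bound survives almost
  everywhere limits, and it bounds the norm of a series by those of its partial sums.\<close>

lemma Lp_integral_Fatou:
  fixes f :: "nat \<Rightarrow> complex^'n \<Rightarrow> complex"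
  assumes [measurable]: "\<And>n. f n \<in> borel_measurable borel" "D \<in> sets borel"
    and lim: "AE z in lborel. z \<in> D \<longrightarrow> (\<lambda>n. f n z) \<longlonglongrightarrow> g z"
    and le: "\<And>n. Lp_integral p D (f n) \<le> C" and p: "0 < p"
  shows "Lp_integral p D g \<le> C"
proof -
  have "Lp_integral p D g \<le>
      (\<integral>\<^sup>+ z. liminf (\<lambda>n. ennreal (norm (f n z) powr p) * indicator D z) \<partial>lborel)"
    unfolding Lp_integral_eq
  proof (rule nn_integral_mono_AE, use lim in eventually_elim)
    fix z assume z: "z \<in> D \<longrightarrow> (\<lambda>n. f n z) \<longlonglongrightarrow> g z"
    show "ennreal (norm (g z) powr p) * indicator D z
        \<le> liminf (\<lambda>n. ennreal (norm (f n z) powr p) * indicator D z)"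
    proof (cases "z \<in> D")
      case True
      then have "(\<lambda>n. ennreal (norm (f n z) powr p)) \<longlonglongrightarrow> ennreal (norm (g z) powr p)"
        using z p by (intro tendsto_intros tendsto_powr2) auto
      from lim_imp_Liminf[OF _ this] show ?thesis using True by simp
    qed simp
  qed
  also have "\<dots> \<le> liminf (\<lambda>n. Lp_integral p D (f n))"
    unfolding Lp_integral_eq by (rule nn_integral_liminf) measurable
  also have "\<dots> \<le> C"
    by (rule order_trans[OF Liminf_mono[of _ "\<lambda>_. C"]]) (use le in \<open>auto simp: Liminf_const\<close>)
  finally show ?thesis .
qed

text \<open>The exceptional points form an open null set, which must be empty.\<close>

lemma AE_open_imp_everywhere:
  fixes f :: "'a::euclidean_space \<Rightarrow> 'b::topological_space"
  assumes "open D" "continuous_on D f" "closed C"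
    and ae: "AE z in lborel. z \<in> D \<longrightarrow> f z \<in> C"
  shows "\<forall>z\<in>D. f z \<in> C"
proof -
  define U where "U = D \<inter> f -` (- C)"
  have "open U"
    unfolding U_def using assms by (intro continuous_open_preimage) auto
  have "AE z in lborel. z \<notin> U"
    using ae by eventually_elim (auto simp: U_def)
  then have "U \<in> null_sets lborel"
    using \<open>open U\<close> by (subst AE_iff_null_sets) auto
  then have "negligible U"
    by (simp add: negligible_iff_null_sets null_sets_completionI)
  then have "U = {}"
    using \<open>open U\<close> open_not_negligible by blast
  then show ?thesis by (auto simp: U_def)
qed

lemma Lp_integral_zero_imp:
  assumes [measurable]: "f \<in> borel_measurable borel" and D: "open D" "continuous_on D f"
    and "Lp_integral p D f = 0" "z \<in> D"
  shows "f z = 0"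
proof -
  have [measurable]: "D \<in> sets borel" using D by simp
  have "AE z in lborel. ennreal (norm (f z) powr p) * indicator D z = 0"
    using assms unfolding Lp_integral_eq by (subst (asm) nn_integral_0_iff_AE) auto
  then have "AE z in lborel. z \<in> D \<longrightarrow> f z \<in> {0}"
    by eventually_elim auto
  then show ?thesis
    using AE_open_imp_everywhere[OF D closed_singleton] \<open>z \<in> D\<close> by blast
qed

section \<open>The metric space\<close>

locale OL_setting =
  fixes \<Omega> :: "(complex^'n) set" and q :: ereal and pj :: "nat \<Rightarrow> real"
  assumes bounded_\<Omega>: "bounded \<Omega>" and open_\<Omega>: "open \<Omega>"
    and q_gt_1: "1 < q"
    and mono_pj: "strict_mono pj" and pj0: "1 < pj 0" and pj_less_q: "\<And>j. ereal (pj j) < q"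
    and pj_lim: "(\<lambda>j. ereal (pj j)) \<longlonglongrightarrow> q"
begin

abbreviation X :: "(complex^'n \<Rightarrow> complex) set" where "X \<equiv> OL_space q \<Omega>"

abbreviation d :: "(complex^'n \<Rightarrow> complex) \<Rightarrow> (complex^'n \<Rightarrow> complex) \<Rightarrow> real"
  where "d \<equiv> OL_dist pj \<Omega>"

lemma pj_gt_1: "1 < pj j"
  using pj0 strict_mono_less_eq[OF mono_pj, of 0 j] by simp

lemma sets_\<Omega> [measurable]: "\<Omega> \<in> sets borel"
  using open_\<Omega> by simp

lemma OL_space_holo: "f \<in> X \<Longrightarrow> holo_on f \<Omega>"
  using q_gt_1 unfolding OL_space_def OL_below_def OL_def one_ereal_def by blast

lemma OL_space_outside: "f \<in> X \<Longrightarrow> z \<notin> \<Omega> \<Longrightarrow> f z = 0"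
  by (simp add: OL_space_def)

lemma OL_space_Lp: "f \<in> X \<Longrightarrow> Lp_integral (pj j) \<Omega> f < \<infinity>"
  using pj_gt_1[of j] pj_less_q[of j] by (auto simp: OL_space_def OL_below_def OL_def)

lemma holo_vanishing_measurable:
  assumes "holo_on f \<Omega>" "\<And>z. z \<notin> \<Omega> \<Longrightarrow> f z = 0"
  shows "f \<in> borel_measurable borel"
proof -
  have "(\<lambda>z. indicator \<Omega> z *\<^sub>R f z) \<in> borel_measurable borel"
    using assms open_\<Omega> by (intro borel_measurable_continuous_on_indicator holo_on_imp_continuous_on) auto
  also have "(\<lambda>z. indicator \<Omega> z *\<^sub>R f z) = f"
    using assms(2) by (auto simp: fun_eq_iff split: split_indicator)
  finally show ?thesis .
qed

lemma OL_space_measurable: "f \<in> X \<Longrightarrow> f \<in> borel_measurable borel"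
  using holo_vanishing_measurable OL_space_holo OL_space_outside by blast

text \<open>The exponents \<open>pj j\<close> suffice: each \<open>p < q\<close> lies below some
  \<open>pj j\<close>, and on a set of finite measure the higher power controls the lower one up to
  the constant 1.\<close>

lemma OL_spaceI:
  assumes holo: "holo_on f \<Omega>" and out: "\<And>z. z \<notin> \<Omega> \<Longrightarrow> f z = 0"
    and fin: "\<And>j. Lp_integral (pj j) \<Omega> f < \<infinity>"
  shows "f \<in> X"
proof -
  have [measurable]: "f \<in> borel_measurable borel"
    using holo out by (rule holo_vanishing_measurable)
  have "Lp_integral p \<Omega> f < \<infinity>" if p: "1 \<le> p" "ereal p < q" for p
  proof -
    obtain j where j: "p < pj j"
      using order_tendstoD(1)[OF pj_lim p(2)] by (auto simp: eventually_sequentially)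
    have pw: "norm w powr p \<le> 1 + norm w powr pj j" for w :: complex
    proof (cases "norm w \<le> 1")
      case True
      then have "norm w powr p \<le> 1"
        using p powr_mono2[of p "norm w" 1] by simp
      then show ?thesis by (simp add: add_increasing2)
    next
      case False
      then have "norm w powr p \<le> norm w powr pj j" using j by (intro powr_mono) auto
      then show ?thesis by simp
    qed
    have "Lp_integral p \<Omega> f \<le>
        (\<integral>\<^sup>+ z. indicator \<Omega> z + ennreal (norm (f z) powr pj j) * indicator \<Omega> z \<partial>lborel)"
      unfolding Lp_integral_eq
    proof (intro nn_integral_mono)
      fix z
      have "ennreal (norm (f z) powr p) \<le> ennreal 1 + ennreal (norm (f z) powr pj j)"
        using pw[of "f z"] by (subst ennreal_plus[symmetric]) (auto intro: ennreal_leI simp del: ennreal_plus)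
      then show "ennreal (norm (f z) powr p) * indicator \<Omega> z
          \<le> indicator \<Omega> z + ennreal (norm (f z) powr pj j) * indicator \<Omega> z"
        by (auto split: split_indicator)
    qed
    also have "\<dots> = emeasure lborel \<Omega> + Lp_integral (pj j) \<Omega> f"
      unfolding Lp_integral_eq by (subst nn_integral_add) auto
    also have "\<dots> < \<infinity>"
      using fin[of j] emeasure_bounded_finite[OF bounded_\<Omega>] by simp
    finally show ?thesis .
  qed
  then show ?thesis
    using holo out by (auto simp: OL_space_def OL_below_def OL_def)
qed

section \<open>Linear structure of \<open>X\<close> and its norms\<close>

lemma OL_space_cmult:
  assumes f: "f \<in> X"
  shows "(\<lambda>z. c * f z) \<in> X"
proof (rule OL_spaceI)
  show "holo_on (\<lambda>z. c * f z) \<Omega>" using f by (intro holo_on_cmult OL_space_holo)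
  show "Lp_integral (pj j) \<Omega> (\<lambda>z. c * f z) < \<infinity>" for j
    using OL_space_Lp[OF f, of j] by (simp add: Lp_integral_cmult OL_space_measurable f ennreal_mult_less_top)
qed (simp add: OL_space_outside f)

lemma OL_space_add:
  assumes f: "f \<in> X" and g: "g \<in> X"
  shows "(\<lambda>z. f z + g z) \<in> X"
proof (rule OL_spaceI)
  show "holo_on (\<lambda>z. f z + g z) \<Omega>" using f g by (intro holo_on_add OL_space_holo)
  show "Lp_integral (pj j) \<Omega> (\<lambda>z. f z + g z) < \<infinity>" for j
    using OL_space_Lp[OF f, of j] OL_space_Lp[OF g, of j] pj_gt_1[of j]
    by (intro Lp_integral_add_finite OL_space_measurable f g) simp_all
qed (simp add: OL_space_outside f g)

lemma OL_space_diff: "f \<in> X \<Longrightarrow> g \<in> X \<Longrightarrow> (\<lambda>z. f z - g z) \<in> X"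
  using OL_space_add[of f "\<lambda>z. -1 * g z"] OL_space_cmult[of g "-1"] by simp

lemma OL_space_zero: "(\<lambda>z. 0) \<in> X"
  by (intro OL_spaceI holo_on_const) (auto simp: Lp_integral_def)

lemma OL_space_sum: "(\<And>k. k \<in> A \<Longrightarrow> F k \<in> X) \<Longrightarrow> (\<lambda>z. \<Sum>k\<in>A. F k z) \<in> X"
proof (induction A rule: infinite_finite_induct)
  case (insert k A)
  then show ?case using OL_space_add[of "F k" "\<lambda>z. \<Sum>k\<in>A. F k z"] by simp
qed (simp_all add: OL_space_zero)

lemma OL_norm_triangle:
  assumes "f \<in> X" "g \<in> X"
  shows "Lp_norm (pj j) \<Omega> (\<lambda>z. f z + g z) \<le> Lp_norm (pj j) \<Omega> f + Lp_norm (pj j) \<Omega> g"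
  using assms pj_gt_1[of j] by (intro Lp_norm_triangle OL_space_measurable OL_space_Lp) auto

lemma OL_norm_cmult:
  assumes "f \<in> X"
  shows "Lp_norm (pj j) \<Omega> (\<lambda>z. c * f z) = norm c * Lp_norm (pj j) \<Omega> f"
  using assms pj_gt_1[of j] by (intro Lp_norm_cmult OL_space_measurable) auto

lemma OL_norm_sum:
  assumes "\<And>k. k \<in> A \<Longrightarrow> F k \<in> X"
  shows "Lp_norm (pj j) \<Omega> (\<lambda>z. \<Sum>k\<in>A. F k z) \<le> (\<Sum>k\<in>A. Lp_norm (pj j) \<Omega> (F k))"
  using assms
proof (induction A rule: infinite_finite_induct)
  case (insert k A)
  then have "Lp_norm (pj j) \<Omega> (\<lambda>z. F k z + (\<Sum>k\<in>A. F k z))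
      \<le> Lp_norm (pj j) \<Omega> (F k) + Lp_norm (pj j) \<Omega> (\<lambda>z. \<Sum>k\<in>A. F k z)"
    by (intro OL_norm_triangle OL_space_sum) auto
  moreover have "Lp_norm (pj j) \<Omega> (\<lambda>z. \<Sum>k\<in>A. F k z) \<le> (\<Sum>k\<in>A. Lp_norm (pj j) \<Omega> (F k))"
    by (rule insert.IH) (use insert.prems in auto)
  ultimately show ?case using insert.hyps by simp
qed (use pj_gt_1[of j] in \<open>simp_all add: Lp_norm_zero\<close>)

lemma OL_norm_eq_0:
  assumes "f \<in> X" "Lp_norm (pj j) \<Omega> f = 0"
  shows "f z = 0"
proof (cases "z \<in> \<Omega>")
  case True
  have "Lp_integral (pj j) \<Omega> f = 0"
    using Lp_integral_eq_Lp_norm[OF OL_space_Lp[OF assms(1), of j]] assms(2) pj_gt_1[of j] by simp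
  then show ?thesis
    using True assms open_\<Omega>
    by (blast intro: Lp_integral_zero_imp OL_space_measurable holo_on_imp_continuous_on OL_space_holo)
qed (simp add: OL_space_outside assms(1))

section \<open>The metric axioms\<close>

definition dterm :: "(complex^'n \<Rightarrow> complex) \<Rightarrow> (complex^'n \<Rightarrow> complex) \<Rightarrow> nat \<Rightarrow> real" where
  "dterm f g j = (1/2) ^ Suc j *
     (Lp_norm (pj j) \<Omega> (\<lambda>z. f z - g z) / (1 + Lp_norm (pj j) \<Omega> (\<lambda>z. f z - g z)))"

lemma d_eq: "d f g = (\<Sum>j. dterm f g j)"
  by (simp add: OL_dist_def dterm_def)

lemma dterm_bounds: "0 \<le> dterm f g j" "dterm f g j \<le> (1/2) ^ Suc j"
proof -
  have "0 \<le> x / (1 + x)" "x / (1 + x) \<le> 1" if "0 \<le> x" for x :: real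
    using that by auto
  from this[OF Lp_norm_nonneg] show "0 \<le> dterm f g j" "dterm f g j \<le> (1/2) ^ Suc j"
    unfolding dterm_def by (simp del: power_Suc, intro mult_left_le) auto
qed

lemma half_powers_summable: "summable (\<lambda>k. (1/2 :: real) ^ k)" "summable (\<lambda>k. (1/2 :: real) ^ Suc k)"
  by (simp_all add: summable_geometric)

lemma summable_dterm: "summable (dterm f g)"
  by (rule summable_comparison_test'[OF half_powers_summable(2)]) (simp add: dterm_bounds del: power_Suc)

text \<open>\<open>t / (1 + t)\<close> is increasing and subadditive, which carries the triangle
  inequality from each norm to the corresponding term of the metric.\<close>

lemma frac_subadditive:
  fixes x y z :: real
  assumes "0 \<le> x" "0 \<le> y" "0 \<le> z" "z \<le> x + y"
  shows "z / (1 + z) \<le> x / (1 + x) + y / (1 + y)"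
proof -
  have "z / (1 + z) \<le> (x + y) / (1 + (x + y))"
    using assms by (simp add: divide_simps algebra_simps)
  also have "\<dots> = x / (1 + (x + y)) + y / (1 + (x + y))"
    by (simp add: add_divide_distrib)
  also have "\<dots> \<le> x / (1 + x) + y / (1 + y)"
    using assms by (intro add_mono divide_left_mono) auto
  finally show ?thesis .
qed

sublocale OL: Metric_space X d
proof
  fix f g show "0 \<le> d f g"
    unfolding d_eq by (intro suminf_nonneg summable_dterm dterm_bounds)
next
  fix f g
  have "Lp_norm p \<Omega> (\<lambda>z. f z - g z) = Lp_norm p \<Omega> (\<lambda>z. g z - f z)" for p
    by (simp add: Lp_norm_def Lp_integral_def norm_minus_commute)
  then show "d f g = d g f" by (simp add: OL_dist_def)
next
  fix f g assume fg: "f \<in> X" "g \<in> X"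
  show "d f g = 0 \<longleftrightarrow> f = g"
  proof
    assume "d f g = 0"
    \<comment> \<open>A vanishing sum of nonnegative terms has a vanishing first term, and the
      single norm for \<open>pj 0\<close> already separates the points of \<open>X\<close>.\<close>
    then have "dterm f g 0 = 0"
      unfolding d_eq using suminf_eq_zero_iff[OF summable_dterm dterm_bounds(1)] by blast
    moreover have "1 + Lp_norm (pj 0) \<Omega> (\<lambda>z. f z - g z) > 0"
      by (intro add_pos_nonneg) auto
    ultimately have "Lp_norm (pj 0) \<Omega> (\<lambda>z. f z - g z) = 0"
      by (simp add: dterm_def)
    then show "f = g"
      using OL_norm_eq_0[OF OL_space_diff[OF fg]] by (auto simp: fun_eq_iff)
  next
    assume "f = g"
    then have "dterm f g j = 0" for j
      using pj_gt_1[of j] by (simp add: dterm_def Lp_norm_zero)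
    then show "d f g = 0" by (simp add: d_eq)
  qed
next
  fix f g h assume fgh: "f \<in> X" "g \<in> X" "h \<in> X"
  have "dterm f h j \<le> dterm f g j + dterm g h j" for j
    using OL_norm_triangle[OF OL_space_diff[OF fgh(1,2)] OL_space_diff[OF fgh(2,3)], of j]
    unfolding dterm_def distrib_left[symmetric] by (intro mult_left_mono frac_subadditive) auto
  then have "(\<Sum>j. dterm f h j) \<le> (\<Sum>j. dterm f g j + dterm g h j)"
    by (intro suminf_le summable_add summable_dterm)
  then show "d f h \<le> d f g + d g h"
    by (simp add: d_eq suminf_add summable_dterm)
qed

section \<open>Convergence in the metric\<close>

lemma d_tendsto_0I:
  assumes "F \<noteq> bot" "\<And>j. ((\<lambda>n. Lp_norm (pj j) \<Omega> (\<lambda>z. f n z - g n z)) \<longlongrightarrow> 0) F"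
  shows "((\<lambda>n. d (f n) (g n)) \<longlongrightarrow> 0) F"
proof -
  have "((\<lambda>n. dterm (f n) (g n) j) \<longlongrightarrow> (1/2) ^ Suc j * (0 / (1 + 0))) F" for j
    unfolding dterm_def by (intro tendsto_intros assms) simp
  \<comment> \<open>Tannery's theorem: each term tends to 0 and the geometric series dominates, so
    limit and sum may be interchanged.\<close>
  then have "((\<lambda>n. \<Sum>j. dterm (f n) (g n) j) \<longlongrightarrow> (\<Sum>j. 0)) F"
    using tannerys_theorem[of "\<lambda>j n. dterm (f n) (g n) j" "\<lambda>_. 0" F "\<lambda>j. (1/2) ^ Suc j"]
      dterm_bounds half_powers_summable(2) assms(1)
    by (simp add: case_prod_unfold)
  then show ?thesis by (simp add: d_eq)
qed

lemma d_tendsto_0D: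
  assumes "(\<lambda>n. d (f n) g) \<longlonglongrightarrow> 0"
  shows "(\<lambda>n. Lp_norm (pj 0) \<Omega> (\<lambda>z. f n z - g z)) \<longlonglongrightarrow> 0"
proof -
  define N where "N = (\<lambda>n. Lp_norm (pj 0) \<Omega> (\<lambda>z. f n z - g z))"
  have pos: "1 + N n > 0" for n unfolding N_def by (intro add_pos_nonneg) auto
  have le0: "dterm (f n) g 0 \<le> d (f n) g" for n
    unfolding d_eq using sum_le_suminf[OF summable_dterm, of "{0}"] dterm_bounds by auto
  have le: "N n / (1 + N n) \<le> 2 * d (f n) g" for n
  proof -
    have "1 / 2 * (N n / (1 + N n)) \<le> d (f n) g"
      using le0[of n] by (simp only: dterm_def N_def power_Suc power_0 mult_1_right)
    then show ?thesis by linarith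
  qed
  have "(\<lambda>n. N n / (1 + N n)) \<longlonglongrightarrow> 0"
  proof (rule tendsto_sandwich[of "\<lambda>_. 0"])
    show "(\<lambda>n. 2 * d (f n) g) \<longlonglongrightarrow> 0" using tendsto_mult_left[OF assms, of 2] by simp
  qed (use le pos in \<open>auto simp: N_def less_imp_le intro!: always_eventually\<close>)
  \<comment> \<open>The map \<open>x / (1 - x)\<close> inverts \<open>x / (1 + x)\<close> and is
    continuous at 0, which recovers \<open>N n\<close> itself.\<close>
  then have "(\<lambda>n. (N n / (1 + N n)) / (1 - N n / (1 + N n))) \<longlonglongrightarrow> 0 / (1 - 0)"
    by (intro tendsto_intros) auto
  moreover have "(N n / (1 + N n)) / (1 - N n / (1 + N n)) = N n" for n
    using pos[of n] by (simp add: field_simps)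
  ultimately show ?thesis by (simp add: N_def)
qed

text \<open>Convergence in the norm for \<open>pj 0\<close> says that the p-th powers
  \<open>u n\<close> of the differences tend to 0 in the L1 sense, and such a sequence has a
  subsequence that tends to 0 almost everywhere.\<close>

lemma d_tendsto_AE_subseq:
  assumes f: "\<And>n. f n \<in> X" and g: "g \<in> X" and lim: "(\<lambda>n. d (f n) g) \<longlonglongrightarrow> 0"
  obtains r where "strict_mono (r :: nat \<Rightarrow> nat)"
    "AE z in lborel. z \<in> \<Omega> \<longrightarrow> (\<lambda>n. f (r n) z) \<longlonglongrightarrow> g z"
proof -
  define p where "p = pj 0"
  have p: "p > 0" using pj0 by (simp add: p_def)
  define u where "u = (\<lambda>n z. norm (f n z - g z) powr p * indicator \<Omega> z)"
  have h: "(\<lambda>z. f n z - g z) \<in> X" for n using OL_space_diff f g by blast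
  have [measurable]: "(\<lambda>z. f n z - g z) \<in> borel_measurable borel" for n
    using h OL_space_measurable by blast
  have [measurable]: "u n \<in> borel_measurable borel" for n unfolding u_def by measurable
  have nn: "(\<integral>\<^sup>+ z. ennreal (u n z) \<partial>lborel) = ennreal (Lp_norm p \<Omega> (\<lambda>z. f n z - g z) powr p)" for n
    using Lp_integral_eq_Lp_norm[OF OL_space_Lp[OF h, of 0], folded p_def, OF p]
    by (simp add: u_def Lp_integral_eq ennreal_mult' ennreal_indicator)
  have int: "integrable lborel (u n)" for n
    by (rule integrableI_nonneg) (auto simp: nn u_def[symmetric] less_top[symmetric], simp add: u_def)
  have "(\<integral>z. norm (u n z) \<partial>lborel) = Lp_norm p \<Omega> (\<lambda>z. f n z - g z) powr p" for n
  proof -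
    have "(\<integral>z. norm (u n z) \<partial>lborel) = (\<integral>z. u n z \<partial>lborel)"
      by (simp add: u_def)
    also have "\<dots> = enn2real (\<integral>\<^sup>+ z. ennreal (u n z) \<partial>lborel)"
      by (rule integral_eq_nn_integral) (auto simp: u_def)
    finally show ?thesis by (simp add: nn)
  qed
  moreover have "(\<lambda>n. Lp_norm p \<Omega> (\<lambda>z. f n z - g z) powr p) \<longlonglongrightarrow> 0 powr p"
    using d_tendsto_0D[OF lim] p by (intro tendsto_powr2) (auto simp: p_def)
  ultimately have "(\<lambda>n. \<integral>z. norm (u n z) \<partial>lborel) \<longlonglongrightarrow> 0" by simp
  then obtain r where r: "strict_mono r" "AE z in lborel. (\<lambda>n. u (r n) z) \<longlonglongrightarrow> 0"
    using tendsto_L1_AE_subseq[of lborel u, OF int] by blast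
  have "AE z in lborel. z \<in> \<Omega> \<longrightarrow> (\<lambda>n. f (r n) z) \<longlonglongrightarrow> g z"
    using r(2)
  proof eventually_elim
    fix z assume z: "(\<lambda>n. u (r n) z) \<longlonglongrightarrow> 0"
    show "z \<in> \<Omega> \<longrightarrow> (\<lambda>n. f (r n) z) \<longlonglongrightarrow> g z"
    proof
      assume "z \<in> \<Omega>"
      then have "(\<lambda>n. (norm (f (r n) z - g z) powr p) powr (1 / p)) \<longlonglongrightarrow> 0 powr (1 / p)"
        using z p by (intro tendsto_powr2) (auto simp: u_def)
      then have "(\<lambda>n. norm (f (r n) z - g z)) \<longlonglongrightarrow> 0"
        using p by (simp add: powr_powr)
      then show "(\<lambda>n. f (r n) z) \<longlonglongrightarrow> g z"
        by (simp add: LIM_zero_iff tendsto_norm_zero_iff)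
    qed
  qed
  with r(1) show ?thesis using that by blast
qed

text \<open>This notion serves two topologies at once: metric convergence in \<open>X\<close> gives
  almost everywhere convergence of a subsequence, and convergence of bounded coefficient sequences
  gives pointwise convergence of the series built from them.\<close>

definition AE_closed :: "(complex^'n \<Rightarrow> complex) set \<Rightarrow> bool" where
  "AE_closed W \<longleftrightarrow> W \<subseteq> X \<and> (\<forall>f g. (\<forall>n. f n \<in> W) \<longrightarrow> g \<in> X \<longrightarrow>
     (AE z in lborel. z \<in> \<Omega> \<longrightarrow> (\<lambda>n::nat. f n z) \<longlonglongrightarrow> g z) \<longrightarrow> g \<in> W)"

lemma AE_closed_imp_closedin:
  assumes "AE_closed W"
  shows "closedin OL.mtopology W"
  unfolding OL.metric_closedin_iff_sequentially_closed
proof (intro conjI allI impI)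
  show WX: "W \<subseteq> X" using assms by (simp add: AE_closed_def)
  fix f g assume fg: "range f \<subseteq> W \<and> limitin OL.mtopology f g sequentially"
  then have "g \<in> X" "(\<lambda>n. d (f n) g) \<longlonglongrightarrow> 0"
    by (auto simp: OL.limitin_metric_dist_null)
  moreover have fW: "f n \<in> W" for n using fg by auto
  ultimately obtain r :: "nat \<Rightarrow> nat" where "AE z in lborel. z \<in> \<Omega> \<longrightarrow> (\<lambda>n. f (r n) z) \<longlonglongrightarrow> g z"
    using d_tendsto_AE_subseq[of f g] WX by (metis subsetD)
  moreover have "\<forall>n. f (r n) \<in> W" using fW by simp
  ultimately show "g \<in> W"
    using assms \<open>g \<in> X\<close> unfolding AE_closed_def
    by (elim conjE allE[of _ "\<lambda>n. f (r n)"] allE[of _ g]) simp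
qed

end

section \<open>Density and category\<close>

text \<open>As \<open>nat\<close> is discrete, this type is the Banach space of all bounded complex
  sequences. A Cauchy sequence in it converges uniformly, and the limit is again bounded.\<close>

lemma complete_bounded_sequences: "complete (UNIV :: (nat \<Rightarrow>\<^sub>C complex) set)"
  unfolding complete_def
proof (intro allI impI)
  fix f :: "nat \<Rightarrow> nat \<Rightarrow>\<^sub>C complex" assume "(\<forall>n. f n \<in> UNIV) \<and> Cauchy f"
  then have "Cauchy f" by simp
  then have "uniformly_Cauchy_on UNIV (\<lambda>n. apply_bcontfun (f n))"
    unfolding uniformly_Cauchy_on_def Cauchy_def by (meson dist_fun_lt_imp_dist_val_lt)
  then obtain g where g: "uniform_limit UNIV (\<lambda>n. apply_bcontfun (f n)) g sequentially"
    using Cauchy_uniformly_convergent uniformly_convergent_on_def by blast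
  show "\<exists>l\<in>UNIV. f \<longlonglongrightarrow> l"
    by (rule uniform_limit_bcontfunE[OF g sequentially_bot], rule bexI) simp_all
qed

section \<open>Series with bounded coefficients\<close>

context OL_setting
begin

text \<open>Geometric decay from some index on, on each compact set and in each norm. The condition
  \<open>j \<le> k\<close> is diagonal: for fixed \<open>j\<close> it leaves finitely many terms
  unrestricted, so one scaling can meet all norms.\<close>

definition admissible :: "(nat \<Rightarrow> complex^'n \<Rightarrow> complex) \<Rightarrow> bool" where
  "admissible F \<longleftrightarrow> (\<forall>k. F k \<in> X) \<and>
     (\<forall>K. compact K \<longrightarrow> K \<subseteq> \<Omega> \<longrightarrow> (\<exists>N. \<forall>k\<ge>N. \<forall>z\<in>K. norm (F k z) \<le> (1/2) ^ k)) \<and>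
     (\<forall>j k. j \<le> k \<longrightarrow> Lp_norm (pj j) \<Omega> (F k) \<le> (1/2) ^ k)"

text \<open>Diagonal choice along an exhaustion of \<open>\<Omega>\<close> by compact sets
  \<open>C k\<close>: divide \<open>f k\<close> by a number that dominates its size on
  \<open>C k\<close> and its norms up to index \<open>k\<close>.\<close>

lemma admissible_scaling_exists:
  assumes f: "\<And>k. f k \<in> X"
  obtains c :: "nat \<Rightarrow> real" where "\<And>k. c k > 0" "admissible (\<lambda>k z. of_real (c k) * f k z)"
proof -
  have "\<exists>C. (\<forall>n. compact (C n) \<and> C n \<subseteq> \<Omega>) \<and>
      (\<forall>K. compact K \<and> K \<subseteq> \<Omega> \<longrightarrow> (\<exists>N::nat. \<forall>n\<ge>N. K \<subseteq> C n))"
  proof (rule open_Union_compact_subsets[OF open_\<Omega>])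
    fix C :: "nat \<Rightarrow> (complex^'n) set"
    assume "\<And>n. compact (C n)" "\<And>n. C n \<subseteq> \<Omega>"
      "\<And>K. compact K \<Longrightarrow> K \<subseteq> \<Omega> \<Longrightarrow> \<exists>N. \<forall>n\<ge>N. K \<subseteq> C n"
    then show ?thesis by (intro exI[of _ C]) simp
  qed
  then obtain C where C: "\<forall>n. compact (C n) \<and> C n \<subseteq> \<Omega>"
    "\<forall>K. compact K \<and> K \<subseteq> \<Omega> \<longrightarrow> (\<exists>N::nat. \<forall>n\<ge>N. K \<subseteq> C n)"
    by (elim exE conjE)
  have "\<exists>B. \<forall>z\<in>C k. norm (f k z) \<le> B" for k
  proof -
    have "compact (f k ` C k)"
      using C(1) continuous_on_subset[OF holo_on_imp_continuous_on[OF OL_space_holo[OF f]]]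
      by (intro compact_continuous_image) simp_all
    then show ?thesis by (auto dest: compact_imp_bounded simp: bounded_iff)
  qed
  then obtain B where B: "\<And>k z. z \<in> C k \<Longrightarrow> norm (f k z) \<le> B k" by metis
  \<comment> \<open>The leading 1 keeps the divisor positive, and the absolute value is there
    because \<open>B k\<close> may be negative when \<open>C k\<close> is empty.\<close>
  define m where "m = (\<lambda>k. 1 + \<bar>B k\<bar> + (\<Sum>j\<le>k. Lp_norm (pj j) \<Omega> (f k)))"
  define c where "c = (\<lambda>k. (1/2) ^ k / m k)"
  have m: "m k > 0" for k
    unfolding m_def by (intro add_pos_nonneg sum_nonneg) auto
  have B_m: "B k \<le> m k" for k
    using sum_nonneg[of "{..k}" "\<lambda>j. Lp_norm (pj j) \<Omega> (f k)"] by (simp add: m_def)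
  have L_m: "Lp_norm (pj j) \<Omega> (f k) \<le> m k" if "j \<le> k" for j k
  proof -
    have "Lp_norm (pj j) \<Omega> (f k) \<le> (\<Sum>j\<le>k. Lp_norm (pj j) \<Omega> (f k))"
      using that by (intro member_le_sum) auto
    then show ?thesis by (simp add: m_def)
  qed
  have c: "c k > 0" for k using m by (simp add: c_def)
  have cm: "c k * x \<le> (1/2) ^ k" if "x \<le> m k" for k x
  proof -
    have "c k * x \<le> c k * m k" using that c[of k] by simp
    also have "\<dots> = (1/2) ^ k" using m[of k] by (simp add: c_def)
    finally show ?thesis .
  qed
  have "admissible (\<lambda>k z. of_real (c k) * f k z)"
    unfolding admissible_def
  proof (intro conjI allI impI)
    show "(\<lambda>z. of_real (c k) * f k z) \<in> X" for k using f by (rule OL_space_cmult)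
    show "Lp_norm (pj j) \<Omega> (\<lambda>z. of_real (c k) * f k z) \<le> (1/2) ^ k" if "j \<le> k" for j k
      using cm[OF L_m[OF that]] c[of k] by (simp add: OL_norm_cmult[OF f])
    fix K assume "compact K" "K \<subseteq> \<Omega>"
    then obtain N where N: "\<forall>n\<ge>N. K \<subseteq> C n" using C(2) by blast
    have "norm (of_real (c k) * f k z) \<le> (1/2) ^ k" if "k \<ge> N" "z \<in> K" for k z
    proof -
      have "z \<in> C k" using N that by blast
      then have "norm (f k z) \<le> m k" using B B_m order_trans by blast
      from cm[OF this] show ?thesis using c[of k] by (simp add: norm_mult)
    qed
    then show "\<exists>N. \<forall>k\<ge>N. \<forall>z\<in>K. norm (of_real (c k) * f k z) \<le> (1/2) ^ k" by blast
  qed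
  with c show ?thesis using that by blast
qed

lemma admissible_abs_summable:
  assumes "admissible F"
  shows "summable (\<lambda>k. norm (F k z))"
proof (cases "z \<in> \<Omega>")
  case True
  then obtain N where "\<forall>k\<ge>N. norm (F k z) \<le> (1/2) ^ k"
    \<comment> \<open>The singleton of \<open>z\<close> is a compact subset of
      \<open>\<Omega>\<close>.\<close>
    using assms unfolding admissible_def by (elim conjE allE[of _ "{z}"]) auto
  then show ?thesis
    by (intro summable_comparison_test'[OF half_powers_summable(1), of N]) simp
next
  case False
  then have "F k z = 0" for k using assms OL_space_outside by (simp add: admissible_def)
  then show ?thesis by simp
qed

lemma admissible_norm_summable:
  assumes "admissible F"
  shows "summable (\<lambda>k. Lp_norm (pj j) \<Omega> (F k))"
  using assms by (intro summable_comparison_test'[OF half_powers_summable(1), of j]) (simp add: admissible_def)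

lemma admissible_series_summable:
  assumes F: "admissible F" and a: "\<And>k. norm (a k :: complex) \<le> A"
  shows "summable (\<lambda>k. a k * F k z)"
  by (rule summable_comparison_test'[OF summable_mult[OF admissible_abs_summable[OF F, of z], of A], of 0])
     (simp add: norm_mult mult_right_mono a)

text \<open>Locally uniform convergence gives holomorphy. The norm bound holds for the partial sums
  by Minkowski and passes to the sum by Fatou; it ensures that small coefficients give small
  elements of \<open>X\<close>.\<close>

lemma admissible_series:
  assumes F: "admissible F" and a: "\<And>k. norm (a k :: complex) \<le> A"
  defines "T \<equiv> \<lambda>z. \<Sum>k. a k * F k z"
  shows "T \<in> X" and "Lp_norm (pj j) \<Omega> T \<le> A * (\<Sum>k. Lp_norm (pj j) \<Omega> (F k))"
proof -
  have FX: "F k \<in> X" for k using F by (simp add: admissible_def)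
  have A: "0 \<le> A" using a[of 0] norm_ge_zero order_trans by blast
  have holo: "holo_on T \<Omega>"
    unfolding T_def
  proof (rule holo_on_suminf[OF open_\<Omega>])
    show "holo_on (\<lambda>z. a k * F k z) \<Omega>" for k
      by (intro holo_on_cmult OL_space_holo FX)
    fix K assume "compact K" "K \<subseteq> \<Omega>"
    then obtain N where N: "\<And>k z. k \<ge> N \<Longrightarrow> z \<in> K \<Longrightarrow> norm (F k z) \<le> (1/2) ^ k"
      using F unfolding admissible_def by metis
    have "norm (a k * F k z) \<le> A * (1/2) ^ k" if "k \<ge> N" "z \<in> K" for k z
      using N[OF that] a[of k] A by (simp only: norm_mult) (intro mult_mono, auto)
    then show "\<exists>M. summable M \<and> (\<forall>\<^sub>F k in sequentially. \<forall>z\<in>K. norm (a k * F k z) \<le> M k)"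
      by (intro exI[of _ "\<lambda>k. A * (1/2) ^ k"])
         (use half_powers_summable(1) in \<open>auto simp: eventually_sequentially intro: summable_mult\<close>)
  qed
  define C where "C = (\<lambda>j. \<Sum>k. Lp_norm (pj j) \<Omega> (F k))"
  have part: "(\<lambda>z. \<Sum>k<n. a k * F k z) \<in> X" for n
    by (intro OL_space_sum OL_space_cmult FX)
  have part_le: "Lp_norm (pj j) \<Omega> (\<lambda>z. \<Sum>k<n. a k * F k z) \<le> A * C j" for j n
  proof -
    have "Lp_norm (pj j) \<Omega> (\<lambda>z. \<Sum>k<n. a k * F k z) \<le> (\<Sum>k<n. Lp_norm (pj j) \<Omega> (\<lambda>z. a k * F k z))"
      by (intro OL_norm_sum OL_space_cmult FX)
    also have "\<dots> \<le> (\<Sum>k<n. A * Lp_norm (pj j) \<Omega> (F k))"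
      by (intro sum_mono) (simp add: OL_norm_cmult[OF FX] mult_right_mono a)
    also have "\<dots> \<le> A * C j"
      unfolding C_def sum_distrib_left[symmetric]
      using A by (intro mult_left_mono sum_le_suminf admissible_norm_summable F) auto
    finally show ?thesis .
  qed
  have int: "Lp_integral (pj j) \<Omega> T \<le> ennreal ((A * C j) powr pj j)" for j
  proof (rule Lp_integral_Fatou)
    show "(\<lambda>z. \<Sum>k<n. a k * F k z) \<in> borel_measurable borel" for n
      by (rule OL_space_measurable[OF part])
    show "AE z in lborel. z \<in> \<Omega> \<longrightarrow> (\<lambda>n. \<Sum>k<n. a k * F k z) \<longlonglongrightarrow> T z"
      unfolding T_def by (simp add: summable_LIMSEQ[OF admissible_series_summable[OF F a]])
    fix n
    have pos: "0 < pj j" using pj_gt_1[of j] by simp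
    show "Lp_integral (pj j) \<Omega> (\<lambda>z. \<Sum>k<n. a k * F k z) \<le> ennreal ((A * C j) powr pj j)"
      unfolding Lp_integral_eq_Lp_norm[OF OL_space_Lp[OF part] pos]
      using part_le pos by (intro ennreal_leI powr_mono2) auto
  qed (use pj_gt_1[of j] in auto)
  show "T \<in> X"
  proof (rule OL_spaceI[OF holo])
    show "T z = 0" if "z \<notin> \<Omega>" for z
      using OL_space_outside[OF FX that] by (simp add: T_def)
    show "Lp_integral (pj j) \<Omega> T < \<infinity>" for j
      using int[of j] by (simp add: le_less_trans)
  qed
  have "0 \<le> C j" unfolding C_def by (intro suminf_nonneg admissible_norm_summable F) auto
  then show "Lp_norm (pj j) \<Omega> T \<le> A * (\<Sum>k. Lp_norm (pj j) \<Omega> (F k))"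
    using int[of j] A pj_gt_1[of j] by (intro Lp_norm_le) (auto simp: C_def)
qed

section \<open>Avoiding countably many closed sets\<close>

lemma AE_closed_subset: "AE_closed W \<Longrightarrow> W \<subseteq> X"
  by (simp add: AE_closed_def)

lemma AE_closedD:
  assumes "AE_closed W" "\<And>n. f n \<in> W" "g \<in> X"
    "\<And>z. z \<in> \<Omega> \<Longrightarrow> (\<lambda>n::nat. f n z) \<longlonglongrightarrow> g z"
  shows "g \<in> W"
proof -
  have "AE z in lborel. z \<in> \<Omega> \<longrightarrow> (\<lambda>n. f n z) \<longlonglongrightarrow> g z" using assms(4) by simp
  with assms(1-3) show ?thesis
    unfolding AE_closed_def by (elim conjE allE[of _ f] allE[of _ g]) simp
qed

text \<open>The complement in \<open>X\<close> is a countable union of closed sets.\<close>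

lemma gdelta_avoiding:
  assumes "countable I" and "\<And>i M. i \<in> I \<Longrightarrow> AE_closed (V i (M :: nat))"
  shows "gdelta_in OL.mtopology {g \<in> X. \<forall>i\<in>I. \<forall>M. g \<notin> V i M}"
proof -
  have "X - {g \<in> X. \<forall>i\<in>I. \<forall>M. g \<notin> V i M} = \<Union> ((\<lambda>(i, M). V i M) ` (I \<times> UNIV))"
    using assms(2) AE_closed_subset by fastforce
  moreover have "fsigma_in OL.mtopology (\<Union> ((\<lambda>(i, M). V i M) ` (I \<times> UNIV)))"
    using assms by (intro fsigma_in_Union)
      (auto intro!: closed_imp_fsigma_in AE_closed_imp_closedin)
  ultimately show ?thesis
    unfolding gdelta_in_fsigma_in by auto
qed

text \<open>Arguing in the Banach space of bounded coefficient sequences rather than in \<open>X\<close> itself avoids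
  the completeness of \<open>X\<close>, and with it the mean value property in several variables.\<close>

lemma dense_avoiding:
  fixes V :: "'i \<Rightarrow> nat \<Rightarrow> (complex^'n \<Rightarrow> complex) set"
  assumes "countable I" and clo: "\<And>i M. i \<in> I \<Longrightarrow> AE_closed (V i M)"
    and f: "\<And>i. i \<in> I \<Longrightarrow> f i \<in> X"
    and esc: "\<And>i g s M M'. i \<in> I \<Longrightarrow> g \<in> V i M \<Longrightarrow> s \<noteq> 0 \<Longrightarrow> (\<lambda>z. g z + s * f i z) \<notin> V i M'"
  shows "OL.mtopology closure_of {g \<in> X. \<forall>i\<in>I. \<forall>M. g \<notin> V i M} = X"
proof (cases "I = {}")
  case True
  then show ?thesis using closure_of_topspace[of OL.mtopology] by simp
next
  case False
  \<comment> \<open>A surjection from the natural numbers onto \<open>I\<close>, repetitions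
    allowed; coefficient number \<open>k\<close> is responsible for condition
    \<open>e k\<close>.\<close>
  define e where "e = from_nat_into I"
  have e: "e k \<in> I" for k unfolding e_def using False by (rule from_nat_into)
  have e_surj: "\<exists>k. e k = i" if "i \<in> I" for i
    using from_nat_into_surj[OF \<open>countable I\<close> that] by (simp add: e_def)
  obtain c where c: "\<And>k. c k > 0" "admissible (\<lambda>k z. of_real (c k) * f (e k) z)"
    using admissible_scaling_exists[of "\<lambda>k. f (e k)"] f e by blast
  define F where "F = (\<lambda>k z. of_real (c k) * f (e k) z)"
  have F: "admissible F" using c(2) by (simp add: F_def)
  \<comment> \<open>\<open>T\<close> maps bounded sequences linearly into \<open>X\<close>; the
    facts below give its continuity both in every norm and at every point.\<close>
  define T where "T = (\<lambda>(a :: nat \<Rightarrow>\<^sub>C complex) z. \<Sum>k. a k * F k z)"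
  have T_sum: "summable (\<lambda>k. a k * F k z)" for a :: "nat \<Rightarrow>\<^sub>C complex" and z
    by (rule admissible_series_summable[OF F norm_bounded])
  have TX: "T a \<in> X" for a
    unfolding T_def by (rule admissible_series(1)[OF F norm_bounded])
  have T_norm: "Lp_norm (pj j) \<Omega> (T a) \<le> norm a * (\<Sum>k. Lp_norm (pj j) \<Omega> (F k))" for j a
    unfolding T_def by (rule admissible_series(2)[OF F norm_bounded])
  have T_diff: "T a z - T b z = T (a - b) z" for a b z
    unfolding T_def by (simp add: suminf_diff[OF T_sum T_sum] minus_bcontfun.rep_eq algebra_simps)
  have T_pt: "norm (T a z) \<le> norm a * (\<Sum>k. norm (F k z))" for a z
  proof -
    have "norm (T a z) \<le> (\<Sum>k. norm a * norm (F k z))"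
      unfolding T_def
      by (intro norm_suminf_le summable_mult admissible_abs_summable F)
         (simp add: norm_mult mult_right_mono norm_bounded)
    then show ?thesis by (simp add: suminf_mult admissible_abs_summable F)
  qed
  have T_lim: "(\<lambda>n. T (a n) z) \<longlonglongrightarrow> T b z" if "a \<longlonglongrightarrow> b" for a b z
  proof (rule Lim_transform_bound[THEN LIM_zero_cancel])
    show "\<forall>\<^sub>F n in sequentially. norm (T (a n) z - T b z) \<le> norm (norm (a n - b) * (\<Sum>k. norm (F k z)))"
      using T_pt by (simp add: T_diff order_trans[OF _ abs_ge_self])
    have "(\<lambda>n. norm (a n - b)) \<longlonglongrightarrow> 0"
      using that by (simp add: LIM_zero tendsto_norm_zero)
    then show "(\<lambda>n. norm (a n - b) * (\<Sum>k. norm (F k z))) \<longlonglongrightarrow> 0"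
      by (rule tendsto_mult_left_zero)
  qed
  have "g0 \<in> OL.mtopology closure_of {g \<in> X. \<forall>i\<in>I. \<forall>M. g \<notin> V i M}" if g0: "g0 \<in> X" for g0
  proof -
    define G where "G = (\<lambda>a z. g0 z + T a z)"
    have GX: "G a \<in> X" for a unfolding G_def by (rule OL_space_add[OF g0 TX])
    \<comment> \<open>The bad coefficient sets, one for each condition and each bound. Each is
      closed with empty interior, so by Baire their union has empty interior.\<close>
    define \<G> where "\<G> = (\<lambda>(k, M). {a. G a \<in> V (e k) M}) ` UNIV"
    have "euclidean interior_of (\<Union>\<G>) = {}"
      unfolding mtopology_is_euclidean[symmetric]
    proof (rule Met_TC.metric_Baire_category_alt)
      show "Met_TC.mcomplete TYPE(nat \<Rightarrow>\<^sub>C complex)" by (simp add: complete_bounded_sequences)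
      show "countable \<G>" unfolding \<G>_def by simp
      fix A assume "A \<in> \<G>"
      then obtain k M where A: "A = {a. G a \<in> V (e k) M}" unfolding \<G>_def by auto
      have "closed A"
        unfolding closed_sequential_limits
      proof (intro allI impI)
        fix a b assume ab: "(\<forall>n. a n \<in> A) \<and> a \<longlonglongrightarrow> b"
        have "G b \<in> V (e k) M"
          by (rule AE_closedD[OF clo[OF e], of "\<lambda>n. G (a n)"])
             (use ab GX in \<open>auto simp: A G_def intro!: tendsto_intros T_lim\<close>)
        then show "b \<in> A" by (simp add: A)
      qed
      \<comment> \<open>A change of the \<open>k\<close>-th coordinate alone moves
        \<open>G a\<close> by a nonzero multiple of \<open>f (e k)\<close>, and by
        \<open>esc\<close> this leaves the set; a ball in \<open>A\<close> would contain both
        sequences.\<close>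
      moreover have "interior A = {}"
      proof (rule ccontr)
        assume "interior A \<noteq> {}"
        then obtain a r where a: "r > 0" "ball a r \<subseteq> A"
          by (metis equals0I mem_interior)
        \<comment> \<open>The perturbation: \<open>r/2\<close> in coordinate \<open>k\<close> and 0
          elsewhere, short enough to stay in the ball of radius \<open>r\<close>.\<close>
        have "(\<lambda>i. if i = k then of_real (r/2) else (0::complex)) \<in> bcontfun"
          by (auto simp: bcontfun_def bounded_iff intro!: exI[of _ "r/2"] continuous_on_discrete) (use a in auto)
        then obtain u :: "nat \<Rightarrow>\<^sub>C complex"
          where u: "(\<lambda>i. if i = k then of_real (r/2) else 0) = apply_bcontfun u"
          by (rule bcontfunE)
        have u_k: "apply_bcontfun u i = (if i = k then of_real (r/2) else 0)" for i
          by (simp add: u[symmetric])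
        have "norm u \<le> r/2"
          using a by (intro norm_bound) (auto simp: u_k)
        then have "a + u \<in> A" using a by (intro subsetD[OF a(2)]) (auto simp: dist_norm)
        moreover have "a \<in> A" using a by (intro subsetD[OF a(2)]) auto
        moreover have "G (a + u) = (\<lambda>z. G a z + of_real (r/2 * c k) * f (e k) z)"
        proof
          fix z
          have "T u z = of_real (r/2) * F k z"
            unfolding T_def using suminf_finite[of "{k}" "\<lambda>i. u i * F i z"] by (simp add: u_k)
          then show "G (a + u) z = G a z + of_real (r/2 * c k) * f (e k) z"
            using T_diff[of "a + u" z a] by (simp add: G_def F_def algebra_simps)
        qed
        ultimately show False
          using esc[OF e, of "G a" k M "of_real (r/2 * c k)" M] a c(1)[of k] by (simp add: A)
      qed
      ultimately show "closedin Met_TC.mtopology A \<and> Met_TC.mtopology interior_of A = {}"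
        by simp
    qed
    then have int: "interior (\<Union>\<G>) = {}" by simp
    \<comment> \<open>A union with empty interior contains no ball around 0, so good coefficients of
      arbitrarily small norm exist.\<close>
    have "\<exists>a. norm a < inverse (real (Suc n)) \<and> a \<notin> \<Union>\<G>" for n
    proof (rule ccontr)
      assume "\<not> ?thesis"
      then have "ball 0 (inverse (real (Suc n))) \<subseteq> \<Union>\<G>" by (auto simp: subset_iff)
      then have "0 \<in> interior (\<Union>\<G>)"
        unfolding mem_interior by (intro exI[of _ "inverse (real (Suc n))"]) simp
      then show False using int by simp
    qed
    then obtain a where a: "\<And>n. norm (a n) < inverse (real (Suc n))" "\<And>n. a n \<notin> \<Union>\<G>" by metis
    have good: "G (a n) \<in> {g \<in> X. \<forall>i\<in>I. \<forall>M. g \<notin> V i M}" for n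
      using a(2)[of n] e_surj GX by (fastforce simp: \<G>_def)
    have lim_a: "(\<lambda>n. norm (a n)) \<longlonglongrightarrow> 0"
      by (rule tendsto_sandwich[OF _ _ tendsto_const LIMSEQ_inverse_real_of_nat])
         (use a(1) in \<open>auto simp: less_imp_le simp del: of_nat_Suc\<close>)
    have "(\<lambda>n. d (G (a n)) g0) \<longlonglongrightarrow> 0"
    proof (rule d_tendsto_0I)
      fix j
      have "(\<lambda>n. norm (a n) * (\<Sum>k. Lp_norm (pj j) \<Omega> (F k))) \<longlonglongrightarrow> 0"
        using lim_a by (rule tendsto_mult_left_zero)
      then have "(\<lambda>n. Lp_norm (pj j) \<Omega> (T (a n))) \<longlonglongrightarrow> 0"
        by (rule tendsto_sandwich[OF _ _ tendsto_const, rotated 2]) (simp_all add: T_norm)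
      then show "(\<lambda>n. Lp_norm (pj j) \<Omega> (\<lambda>z. G (a n) z - g0 z)) \<longlonglongrightarrow> 0"
        by (simp add: G_def)
    qed simp
    then have "\<exists>n. d g0 (G (a n)) < r" if "r > 0" for r
      using order_tendstoD(2)[of _ 0 sequentially r] that
      by (fastforce simp: eventually_sequentially OL.commute)
    then show ?thesis
      unfolding OL.metric_closure_of using good g0 GX by (fastforce simp: OL.in_mball)
  qed
  moreover have "OL.mtopology closure_of S \<subseteq> X" for S
    using closure_of_subset_topspace[of OL.mtopology S] by simp
  ultimately show ?thesis by blast
qed

end

section \<open>Reduction to countably many conditions\<close>

text \<open>Balls with radii \<open>1 / real (Suc n)\<close> and centres in a countable dense set.
  Connectedness is recorded for the argument that components reach the frontier.\<close>

lemma countable_connected_base: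
  obtains \<B> :: "'a::euclidean_space set set"
  where "countable \<B>" "\<And>B. B \<in> \<B> \<Longrightarrow> open B" "\<And>B. B \<in> \<B> \<Longrightarrow> connected B"
    "\<And>x U. open U \<Longrightarrow> x \<in> U \<Longrightarrow> \<exists>B\<in>\<B>. x \<in> B \<and> B \<subseteq> U"
proof -
  obtain D :: "'a set" where D: "countable D" "\<And>U. open U \<Longrightarrow> U \<noteq> {} \<Longrightarrow> \<exists>d\<in>D. d \<in> U"
    using countable_dense_setE by blast
  define \<B> where "\<B> = (\<lambda>(a, n). ball a (1 / real (Suc n))) ` (D \<times> UNIV)"
  show ?thesis
  proof (rule that[of \<B>])
    show "countable \<B>" unfolding \<B>_def using D(1) by blast
    show "open B" "connected B" if "B \<in> \<B>" for B
      using that unfolding \<B>_def by auto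
    fix x :: 'a and U assume "open U" "x \<in> U"
    then obtain e where e: "e > 0" "ball x e \<subseteq> U" using open_contains_ball by blast
    obtain n where n: "1 / real (Suc n) < e / 2"
      using nat_approx_posE[of "e / 2"] e(1) by auto
    define r where "r = 1 / real (Suc n)"
    have r: "r > 0" "r < e / 2" using n by (auto simp: r_def)
    obtain a where a: "a \<in> D" "a \<in> ball x r"
      using D(2)[of "ball x r"] r(1) by auto
    have "ball a r \<subseteq> U"
    proof
      fix y assume "y \<in> ball a r"
      then have "dist x y < e" using a(2) r dist_triangle[of x y a] by simp
      then show "y \<in> U" using e(2) by auto
    qed
    moreover have "x \<in> ball a r" using a(2) by (simp add: dist_commute)
    moreover have "ball a r \<in> \<B>" unfolding \<B>_def r_def using a(1) by auto
    ultimately show "\<exists>B\<in>\<B>. x \<in> B \<and> B \<subseteq> U" by blast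
  qed
qed

text \<open>The connected set \<open>B\<close> meets both \<open>E\<close> and its complement, hence
  the frontier of \<open>E\<close>. A point found there is outside \<open>S\<close>, because
  \<open>E\<close> is open and relatively closed in \<open>B \<inter> S\<close>.\<close>

lemma component_closure_meets_frontier:
  fixes S :: "'a::euclidean_space set"
  assumes "open S" "open B" "connected B" "B \<inter> frontier S \<noteq> {}" "E \<in> components (B \<inter> S)"
  obtains \<zeta> where "\<zeta> \<in> closure E" "\<zeta> \<in> B" "\<zeta> \<in> frontier S"
proof -
  have E: "E \<subseteq> B \<inter> S" "E \<noteq> {}" "open E"
    using assms in_components_subset in_components_nonempty open_components[of "B \<inter> S"] by blast+
  have "B \<inter> frontier E \<noteq> {}"
  proof (rule connected_Int_frontier[OF \<open>connected B\<close>])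
    show "B \<inter> E \<noteq> {}" using E by blast
    show "B - E \<noteq> {}"
      using assms(1,4) E(1) by (auto simp: frontier_def interior_open)
  qed
  then obtain \<zeta> where \<zeta>: "\<zeta> \<in> B" "\<zeta> \<in> closure E" "\<zeta> \<notin> E"
    using E(3) by (auto simp: frontier_def interior_open)
  have "\<zeta> \<notin> S"
  proof
    assume "\<zeta> \<in> S"
    obtain T where T: "closed T" "E = B \<inter> S \<inter> T"
      using closedin_component[OF assms(5)] by (auto simp: closedin_closed)
    then have "closure E \<subseteq> T" by (simp add: closure_minimal)
    then show False using \<zeta> T \<open>\<zeta> \<in> S\<close> by auto
  qed
  moreover have "\<zeta> \<in> closure S" using \<zeta>(2) E(1) closure_mono[of E S] by blast
  ultimately show ?thesis
    using that \<zeta> \<open>open S\<close> by (auto simp: frontier_def interior_open)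
qed

text \<open>\<open>E\<close> has points in the neighbourhood \<open>B'\<close> of
  \<open>\<zeta>\<close>; the component of \<open>B' \<inter> S\<close> through such a point is
  connected and meets \<open>E\<close>. Bounds on \<open>E\<close> thus pass to a component over the
  smaller set.\<close>

lemma component_contains_component:
  fixes S :: "'a::topological_space set"
  assumes "E \<in> components (B \<inter> S)" "\<zeta> \<in> closure E" "\<zeta> \<in> B'" "open B'" "B' \<subseteq> B"
  obtains E' where "E' \<in> components (B' \<inter> S)" "E' \<subseteq> E"
proof -
  obtain x where x: "x \<in> E" "x \<in> B'"
    using assms(2-4) closure_iff_nhds_not_empty[of \<zeta> E] by blast
  then have "x \<in> B' \<inter> S" using in_components_subset[OF assms(1)] by blast
  then obtain E' where E': "E' \<in> components (B' \<inter> S)" "x \<in> E'"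
    by (metis Union_components UnionE)
  have "E' \<subseteq> E"
    by (rule components_maximal[OF assms(1)])
       (use E' x in_components_subset[OF E'(1)] in_components_connected[OF E'(1)] assms(5) in auto)
  with E'(1) show ?thesis using that by blast
qed

text \<open>Bounds by natural numbers present the condition as a countable union.\<close>

lemma bounded_image_iff_nat: "bounded (f ` E) \<longleftrightarrow> (\<exists>M::nat. \<forall>z\<in>E. norm (f z) \<le> real M)"
proof
  assume "bounded (f ` E)"
  then obtain b where "\<forall>z\<in>E. norm (f z) \<le> b" by (auto simp: bounded_iff)
  then show "\<exists>M::nat. \<forall>z\<in>E. norm (f z) \<le> real M"
    using real_arch_simple[of b] by (meson order_trans)
qed (auto simp: bounded_iff)

lemma ennreal_finite_iff_nat: "x < top \<longleftrightarrow> (\<exists>M::nat. x \<le> ennreal (real M))"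
proof
  assume "x < top"
  then obtain M :: nat where "x < of_nat M" using ennreal_Ex_less_of_nat by blast
  then show "\<exists>M::nat. x \<le> ennreal (real M)"
    by (auto simp: ennreal_of_nat_eq_real_of_nat intro: less_imp_le)
qed (auto intro: le_less_trans)

lemma OLq_subset:
  assumes "OLq q E f" "D \<subseteq> E"
  shows "OLq q D f"
  using assms Lp_integral_mono_set[OF assms(2)]
  by (auto simp: OLq_def OL_def OL_inf_def intro: holo_on_subset bounded_subset[OF _ image_mono]
      le_less_trans split: if_splits)

lemma holo_on_cong_iff:
  assumes "open D" "\<And>z. z \<in> D \<Longrightarrow> f z = g z"
  shows "holo_on f D \<longleftrightarrow> holo_on g D"
  using holo_on_cong[of D f g] holo_on_cong[of D g f] assms by metis

lemma OLq_cong: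
  assumes "open D" "\<And>z. z \<in> D \<Longrightarrow> f z = g z"
  shows "OLq q D f \<longleftrightarrow> OLq q D g"
proof -
  have "f ` D = g ` D" using assms(2) by (rule image_cong[OF refl])
  then show ?thesis
    using holo_on_cong_iff[of D f g, OF assms] Lp_integral_cong[of D f g, OF assms(2)]
    by (simp add: OLq_def OL_def OL_inf_def)
qed

section \<open>The boundary conditions as countable unions of closed sets\<close>

context OL_setting
begin

text \<open>A pair \<open>(b, D)\<close> stands for one condition to be avoided: boundedness on \<open>D\<close> if \<open>b\<close> holds, and
  q-integrability over \<open>D\<close> otherwise (only used for finite \<open>q\<close>).\<close>

definition tame :: "bool \<times> (complex^'n) set \<Rightarrow> nat \<Rightarrow> (complex^'n \<Rightarrow> complex) set" where
  "tame i M = (if fst i then {g \<in> X. \<forall>z\<in>snd i. norm (g z) \<le> real M}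
     else {g \<in> X. Lp_integral (real_of_ereal q) (snd i) g \<le> ennreal (real M)})"

lemma real_q: "q \<noteq> \<infinity> \<Longrightarrow> 1 < real_of_ereal q"
  using q_gt_1 by (cases q) auto

text \<open>For boundedness, almost everywhere limits stay in a closed disc, and continuity on the
  open set \<open>D\<close> removes the exceptional points. For integrability this is Fatou's
  lemma.\<close>

lemma AE_closed_tame:
  assumes D: "open D" "D \<subseteq> \<Omega>" and b: "b \<or> q \<noteq> \<infinity>"
  shows "AE_closed (tame (b, D) M)"
  unfolding AE_closed_def
proof (intro conjI allI impI)
  show "tame (b, D) M \<subseteq> X" by (auto simp: tame_def)
  fix f g
  assume f: "\<forall>n::nat. f n \<in> tame (b, D) M" and g: "g \<in> X"
    and lim: "AE z in lborel. z \<in> \<Omega> \<longrightarrow> (\<lambda>n. f n z) \<longlonglongrightarrow> g z"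
  have fX: "f n \<in> X" for n using f by (auto simp: tame_def split: if_splits)
  show "g \<in> tame (b, D) M"
  proof (cases b)
    case True
    have "AE z in lborel. z \<in> D \<longrightarrow> g z \<in> cball 0 (real M)"
      using lim
    proof eventually_elim
      fix z assume z: "z \<in> \<Omega> \<longrightarrow> (\<lambda>n. f n z) \<longlonglongrightarrow> g z"
      show "z \<in> D \<longrightarrow> g z \<in> cball 0 (real M)"
      proof
        assume "z \<in> D"
        then have "(\<lambda>n. f n z) \<longlonglongrightarrow> g z" "\<And>n. f n z \<in> cball 0 (real M)"
          using z D f True by (auto simp: tame_def)
        then show "g z \<in> cball 0 (real M)"
          by (rule closed_sequentially[OF closed_cball, rotated])
      qed
    qed
    then have "\<forall>z\<in>D. g z \<in> cball 0 (real M)"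
      by (rule AE_open_imp_everywhere[OF D(1) _ closed_cball, rotated])
         (rule continuous_on_subset[OF holo_on_imp_continuous_on[OF OL_space_holo[OF g]] D(2)])
    then show ?thesis using True g by (simp add: tame_def)
  next
    case False
    have "Lp_integral (real_of_ereal q) D g \<le> ennreal (real M)"
    proof (rule Lp_integral_Fatou)
      show "AE z in lborel. z \<in> D \<longrightarrow> (\<lambda>n. f n z) \<longlonglongrightarrow> g z"
        using lim by eventually_elim (use D in auto)
      show "Lp_integral (real_of_ereal q) D (f n) \<le> ennreal (real M)" for n
        using f False by (simp add: tame_def)
      show "0 < real_of_ereal q" using real_q b False by simp
    qed (use fX D OL_space_measurable in auto)
    then show ?thesis using False g by (simp add: tame_def)
  qed
qed

text \<open>The union of \<open>tame (b, D) M\<close> over all \<open>M\<close> is a linear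
  subspace. If it contained both \<open>g\<close> and \<open>g + s f\<close>, it would contain
  \<open>f\<close>, which is a combination of the two.\<close>

lemma tame_escape:
  assumes D: "open D" "D \<subseteq> \<Omega>" and b: "b \<or> q \<noteq> \<infinity>"
    and f: "f \<in> X" "\<And>M. f \<notin> tame (b, D) M" and g: "g \<in> tame (b, D) M" and s: "s \<noteq> 0"
  shows "(\<lambda>z. g z + s * f z) \<notin> tame (b, D) M'"
proof
  assume h: "(\<lambda>z. g z + s * f z) \<in> tame (b, D) M'"
  show False
  proof (cases b)
    case True
    have "norm (f z) \<le> real (M + M') / norm s" if "z \<in> D" for z
    proof -
      have "norm (s * f z) \<le> norm (g z + s * f z) + norm (g z)"
        using norm_triangle_ineq4[of "g z + s * f z" "g z"] by simp
      also have "\<dots> \<le> real M' + real M"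
        using g h that True by (intro add_mono) (simp_all add: tame_def)
      finally show ?thesis using s by (simp add: norm_mult field_simps)
    qed
    then have "bounded (f ` D)" by (auto simp: bounded_iff)
    then show False using f True by (auto simp: bounded_image_iff_nat tame_def)
  next
    case False
    define r where "r = real_of_ereal q"
    have r: "1 < r" using real_q b False by (simp add: r_def)
    have gX: "g \<in> X" using g by (auto simp: tame_def split: if_splits)
    have hX: "(\<lambda>z. g z + s * f z) \<in> X" using h by (auto simp: tame_def split: if_splits)
    have [simp]: "D \<in> sets borel" using D by simp
    have fin: "Lp_integral r D g < \<infinity>" "Lp_integral r D (\<lambda>z. g z + s * f z) < \<infinity>"
      using g h False by (auto simp: tame_def r_def intro: le_less_trans)
    have "Lp_integral r D (\<lambda>z. (- 1 / s) * g z) < \<infinity>" "Lp_integral r D (\<lambda>z. (1 / s) * (g z + s * f z)) < \<infinity>"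
      using fin by (simp_all only: Lp_integral_cmult[OF OL_space_measurable[OF gX] \<open>D \<in> sets borel\<close>]
          Lp_integral_cmult[OF OL_space_measurable[OF hX] \<open>D \<in> sets borel\<close>])
        (simp_all add: ennreal_mult_less_top)
    then have "Lp_integral r D (\<lambda>z. (- 1 / s) * g z + (1 / s) * (g z + s * f z)) < \<infinity>"
      using r by (intro Lp_integral_add_finite OL_space_measurable OL_space_cmult gX hX) auto
    moreover have "(\<lambda>z. (- 1 / s) * g z + (1 / s) * (g z + s * f z)) = f"
      using s by (simp add: fun_eq_iff field_simps)
    ultimately have "Lp_integral r D f < \<infinity>" by simp
    then show False using f False ennreal_finite_iff_nat by (auto simp: tame_def r_def)
  qed
qed

text \<open>Holomorphy is automatic for members of \<open>X\<close>, so only the size condition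
  remains; the flag \<open>q = \<infinity>\<close> selects the supremum or the integral.\<close>

lemma OLq_iff_tame:
  assumes g: "g \<in> X" and D: "D \<subseteq> \<Omega>"
  shows "OLq q D g \<longleftrightarrow> (\<exists>M. g \<in> tame (q = \<infinity>, D) M)"
proof -
  have holo: "holo_on g D" using OL_space_holo[OF g] D holo_on_subset by blast
  show ?thesis
    using holo g unfolding OLq_def OL_def OL_inf_def tame_def bounded_image_iff_nat
    by (cases "q = \<infinity>") (simp_all add: ennreal_finite_iff_nat)
qed

text \<open>The given function is arbitrary off \<open>\<Omega>\<close>, whereas members of
  \<open>X\<close> vanish there. Replacing its values by 0 is harmless, as all the properties depend
  on the values in \<open>\<Omega>\<close> alone.\<close>

lemma singular_function_in_OL_space:
  assumes "OL_below q \<Omega> f" "\<forall>\<epsilon>>0. \<not> OLq q (ball \<zeta> \<epsilon> \<inter> \<Omega>) f" "filterlim f at_infinity (at \<zeta> within \<Omega>)"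
  obtains g where "g \<in> X" "\<And>\<epsilon>. \<epsilon> > 0 \<Longrightarrow> \<not> OLq q (ball \<zeta> \<epsilon> \<inter> \<Omega>) g"
    "filterlim g at_infinity (at \<zeta> within \<Omega>)"
proof (rule that)
  define g where "g = (\<lambda>z. if z \<in> \<Omega> then f z else 0)"
  have eq: "f z = g z" if "z \<in> \<Omega>" for z using that by (simp add: g_def)
  show "g \<in> X"
    using assms(1) holo_on_cong_iff[of \<Omega> f g, OF open_\<Omega> eq] Lp_integral_cong[of \<Omega> f g, OF eq]
    by (simp add: OL_space_def OL_below_def OL_def) (simp add: g_def)
  show "\<not> OLq q (ball \<zeta> \<epsilon> \<inter> \<Omega>) g" if "\<epsilon> > 0" for \<epsilon>
    using assms(2) that OLq_cong[of "ball \<zeta> \<epsilon> \<inter> \<Omega>" f g q] open_\<Omega> eq by auto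
  have "\<forall>\<^sub>F z in at \<zeta> within \<Omega>. f z = g z"
    by (auto simp: eventually_at_filter eq)
  then show "filterlim g at_infinity (at \<zeta> within \<Omega>)"
    using assms(3) filterlim_cong[OF refl refl] by blast
qed

text \<open>\<open>\<zeta>\<close> is a limit point of \<open>E\<close>, being in its closure but
  not in \<open>E\<close>, so \<open>f\<close> tends to infinity along points of
  \<open>E\<close>.\<close>

lemma blow_up_imp_unbounded:
  fixes f :: "complex^'n \<Rightarrow> complex"
  assumes "filterlim f at_infinity (at \<zeta> within \<Omega>)" "E \<subseteq> \<Omega>" "\<zeta> \<in> closure E" "\<zeta> \<notin> E"
  shows "\<not> bounded (f ` E)"
proof
  assume "bounded (f ` E)"
  then obtain b where b: "\<forall>z\<in>E. norm (f z) \<le> b" by (auto simp: bounded_iff)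
  have "filterlim f at_infinity (at \<zeta> within E)"
    using assms(1) at_le[OF assms(2)] by (rule filterlim_mono[OF _ order_refl])
  then have "\<forall>\<^sub>F z in at \<zeta> within E. norm (f z) \<ge> \<bar>b\<bar> + 1"
    unfolding filterlim_at_infinity[OF order_refl] by simp
  moreover have "\<forall>\<^sub>F z in at \<zeta> within E. z \<in> E"
    by (simp add: eventually_at_filter)
  ultimately have "\<forall>\<^sub>F z in at \<zeta> within E. False"
    by eventually_elim (use b in force)
  then have "at \<zeta> within E = bot" by (simp add: trivial_limit_def)
  then show False
    using assms(3,4) by (simp add: trivial_limit_within closure_def)
qed

text \<open>In both directions a component \<open>E\<close> with bounded image accumulates at a
  frontier point \<open>\<zeta>\<close>, and a smaller neighbourhood of \<open>\<zeta>\<close> of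
  the other kind has a component inside \<open>E\<close>, where \<open>g\<close> is bounded as
  well.\<close>

lemma totally_unbounded_iff_base:
  assumes base: "\<And>B. B \<in> \<B> \<Longrightarrow> open B" "\<And>B. B \<in> \<B> \<Longrightarrow> connected B"
    "\<And>x U. open U \<Longrightarrow> x \<in> U \<Longrightarrow> \<exists>B\<in>\<B>. x \<in> B \<and> B \<subseteq> U"
  shows "totally_unbounded g \<Omega> \<longleftrightarrow>
    (\<forall>B\<in>\<B>. B \<inter> frontier \<Omega> \<noteq> {} \<longrightarrow> (\<forall>E\<in>components (B \<inter> \<Omega>). \<not> bounded (g ` E)))"
proof
  assume tu: "totally_unbounded g \<Omega>"
  show "\<forall>B\<in>\<B>. B \<inter> frontier \<Omega> \<noteq> {} \<longrightarrow> (\<forall>E\<in>components (B \<inter> \<Omega>). \<not> bounded (g ` E))"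
  proof (intro ballI impI notI)
    fix B E assume B: "B \<in> \<B>" "B \<inter> frontier \<Omega> \<noteq> {}" and E: "E \<in> components (B \<inter> \<Omega>)" "bounded (g ` E)"
    obtain \<zeta> where \<zeta>: "\<zeta> \<in> closure E" "\<zeta> \<in> B" "\<zeta> \<in> frontier \<Omega>"
      by (rule component_closure_meets_frontier[OF open_\<Omega> base(1,2)[OF B(1)] B(2) E(1)])
    obtain \<delta> where \<delta>: "\<delta> > 0" "ball \<zeta> \<delta> \<subseteq> B"
      using base(1)[OF B(1)] \<zeta>(2) open_contains_ball by blast
    obtain E' where E': "E' \<in> components (ball \<zeta> \<delta> \<inter> \<Omega>)" "E' \<subseteq> E"
      using component_contains_component[OF E(1) \<zeta>(1) _ open_ball \<delta>(2)] \<delta>(1) by auto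
    have "bounded (g ` E')" using E(2) E'(2) by (meson bounded_subset image_mono)
    then show False using tu \<zeta>(3) \<delta>(1) E'(1) unfolding totally_unbounded_def by blast
  qed
next
  assume R: "\<forall>B\<in>\<B>. B \<inter> frontier \<Omega> \<noteq> {} \<longrightarrow> (\<forall>E\<in>components (B \<inter> \<Omega>). \<not> bounded (g ` E))"
  show "totally_unbounded g \<Omega>"
    unfolding totally_unbounded_def
  proof (intro ballI allI impI notI)
    fix w \<delta> E assume w: "w \<in> frontier \<Omega>" "\<delta> > (0::real)"
      and E: "E \<in> components (ball w \<delta> \<inter> \<Omega>)" "bounded (g ` E)"
    have "ball w \<delta> \<inter> frontier \<Omega> \<noteq> {}" using w centre_in_ball by blast
    \<comment> \<open>\<open>E\<close> need not accumulate at the centre \<open>w\<close>, so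
      another frontier point in the ball takes its place.\<close>
    then obtain \<zeta> where \<zeta>: "\<zeta> \<in> closure E" "\<zeta> \<in> ball w \<delta>" "\<zeta> \<in> frontier \<Omega>"
      using component_closure_meets_frontier[OF open_\<Omega> open_ball connected_ball _ E(1)] by blast
    obtain B where B: "B \<in> \<B>" "\<zeta> \<in> B" "B \<subseteq> ball w \<delta>"
      using base(3)[OF open_ball \<zeta>(2)] by blast
    obtain E' where E': "E' \<in> components (B \<inter> \<Omega>)" "E' \<subseteq> E"
      using component_contains_component[OF E(1) \<zeta>(1) B(2) base(1)[OF B(1)] B(3)] by blast
    have "bounded (g ` E')" using E(2) E'(2) by (meson bounded_subset image_mono)
    then show False using R B \<zeta>(3) E'(1) by blast
  qed
qed

lemma nowhere_OLq_iff_base: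
  assumes base: "\<And>B. B \<in> \<B> \<Longrightarrow> open B"
    "\<And>x U. open U \<Longrightarrow> x \<in> U \<Longrightarrow> \<exists>B\<in>\<B>. x \<in> B \<and> B \<subseteq> U"
  shows "(\<forall>\<zeta>\<in>frontier \<Omega>. \<forall>\<epsilon>>0. \<not> OLq q (ball \<zeta> \<epsilon> \<inter> \<Omega>) g) \<longleftrightarrow>
    (\<forall>B\<in>\<B>. B \<inter> frontier \<Omega> \<noteq> {} \<longrightarrow> \<not> OLq q (B \<inter> \<Omega>) g)"
proof
  assume L: "\<forall>\<zeta>\<in>frontier \<Omega>. \<forall>\<epsilon>>0. \<not> OLq q (ball \<zeta> \<epsilon> \<inter> \<Omega>) g"
  show "\<forall>B\<in>\<B>. B \<inter> frontier \<Omega> \<noteq> {} \<longrightarrow> \<not> OLq q (B \<inter> \<Omega>) g"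
  proof (intro ballI impI notI)
    fix B assume B: "B \<in> \<B>" "B \<inter> frontier \<Omega> \<noteq> {}" "OLq q (B \<inter> \<Omega>) g"
    then obtain \<zeta> where \<zeta>: "\<zeta> \<in> B" "\<zeta> \<in> frontier \<Omega>" by blast
    obtain \<epsilon> where \<epsilon>: "\<epsilon> > 0" "ball \<zeta> \<epsilon> \<subseteq> B"
      using base(1)[OF B(1)] \<zeta>(1) open_contains_ball by blast
    have "OLq q (ball \<zeta> \<epsilon> \<inter> \<Omega>) g" by (rule OLq_subset[OF B(3)]) (use \<epsilon>(2) in blast)
    then show False using L \<zeta>(2) \<epsilon>(1) by blast
  qed
next
  assume R: "\<forall>B\<in>\<B>. B \<inter> frontier \<Omega> \<noteq> {} \<longrightarrow> \<not> OLq q (B \<inter> \<Omega>) g"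
  show "\<forall>\<zeta>\<in>frontier \<Omega>. \<forall>\<epsilon>>0. \<not> OLq q (ball \<zeta> \<epsilon> \<inter> \<Omega>) g"
  proof (intro ballI allI impI notI)
    fix \<zeta> \<epsilon> assume \<zeta>: "\<zeta> \<in> frontier \<Omega>" "\<epsilon> > (0::real)" "OLq q (ball \<zeta> \<epsilon> \<inter> \<Omega>) g"
    then obtain B where B: "B \<in> \<B>" "\<zeta> \<in> B" "B \<subseteq> ball \<zeta> \<epsilon>"
      using base(2)[OF open_ball centre_in_ball[THEN iffD2]] by blast
    have "OLq q (B \<inter> \<Omega>) g" by (rule OLq_subset[OF \<zeta>(3)]) (use B(3) in blast)
    then show False using R B \<zeta>(1) by blast
  qed
qed

text \<open>\<open>R\<close> is rewritten as the set of all \<open>g\<close> in \<open>X\<close>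
  that avoid countably many \<open>tame\<close> sets, to which the two avoidance lemmas
  apply.\<close>

lemma dense_gdelta:
  assumes sing: "\<forall>\<zeta>\<in>frontier \<Omega>. \<exists>f. OL_below q \<Omega> f
           \<and> (\<forall>\<epsilon>>0. \<not> OLq q (ball \<zeta> \<epsilon> \<inter> \<Omega>) f)
           \<and> filterlim f at_infinity (at \<zeta> within \<Omega>)"
  defines "R \<equiv> {g \<in> X. totally_unbounded g \<Omega> \<and> (\<forall>\<zeta>\<in>frontier \<Omega>. \<forall>\<epsilon>>0. \<not> OLq q (ball \<zeta> \<epsilon> \<inter> \<Omega>) g)}"
  shows "OL.mtopology closure_of R = X \<and> gdelta_in OL.mtopology R"
proof -
  obtain \<A> :: "(complex^'n) set set" where \<A>: "countable \<A>"
    "\<And>B. B \<in> \<A> \<Longrightarrow> open B" "\<And>B. B \<in> \<A> \<Longrightarrow> connected B"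
    "\<And>x U. open U \<Longrightarrow> x \<in> U \<Longrightarrow> \<exists>B\<in>\<A>. x \<in> B \<and> B \<subseteq> U"
    using countable_connected_base by blast
  define \<B> where "\<B> = {B \<in> \<A>. B \<inter> frontier \<Omega> \<noteq> {}}"
  \<comment> \<open>First family: boundedness on the components over base sets that meet the
    frontier. Second family: membership in \<open>OLq q\<close> over the whole of
    \<open>B \<inter> \<Omega>\<close>, which is boundedness if \<open>q = \<infinity>\<close> and
    integrability otherwise; this explains the flag.\<close>
  define I where "I = Pair True ` (\<Union>B\<in>\<B>. components (B \<inter> \<Omega>)) \<union> (\<lambda>B. (q = \<infinity>, B \<inter> \<Omega>)) ` \<B>"
  have \<B>: "countable \<B>" using \<A>(1) by (simp add: \<B>_def)
  have op: "open (B \<inter> \<Omega>)" if "B \<in> \<B>" for B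
    using that \<A>(2) open_\<Omega> by (auto simp: \<B>_def)
  \<comment> \<open>Disjoint nonempty open sets in a separable space are countable in
    number.\<close>
  have "countable (components (B \<inter> \<Omega>))" if "B \<in> \<B>" for B
  proof (rule countable_disjoint_open_subsets)
    show "open E" if "E \<in> components (B \<inter> \<Omega>)" for E
      using op[OF \<open>B \<in> \<B>\<close>] that by (rule open_components)
    show "disjoint (components (B \<inter> \<Omega>))"
      using pairwise_disjoint_components[of "B \<inter> \<Omega>"] by (simp add: pairwise_def disjnt_def)
  qed
  then have I: "countable I" unfolding I_def using \<B> by auto
  have I_props: "open (snd i) \<and> snd i \<subseteq> \<Omega> \<and> (fst i \<or> q \<noteq> \<infinity>)" if "i \<in> I" for i
    using that op open_components[OF op] in_components_subset unfolding I_def by fastforce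
  have sing': "\<exists>f\<in>X. (\<forall>\<epsilon>>0. \<not> OLq q (ball \<zeta> \<epsilon> \<inter> \<Omega>) f) \<and> filterlim f at_infinity (at \<zeta> within \<Omega>)"
    if "\<zeta> \<in> frontier \<Omega>" for \<zeta>
    using sing that singular_function_in_OL_space by metis
  have ex: "\<exists>f\<in>X. \<forall>M. f \<notin> tame i M" if i: "i \<in> I" for i
  proof -
    consider B E where "B \<in> \<B>" "E \<in> components (B \<inter> \<Omega>)" "i = (True, E)"
      | B where "B \<in> \<B>" "i = (q = \<infinity>, B \<inter> \<Omega>)"
      using i unfolding I_def by blast
    then show ?thesis
    proof cases
      case 1
      \<comment> \<open>The singular function is taken at a frontier point in the closure of
        \<open>E\<close>, where its blow-up makes it unbounded on \<open>E\<close>.\<close>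
      obtain \<zeta> where \<zeta>: "\<zeta> \<in> closure E" "\<zeta> \<in> B" "\<zeta> \<in> frontier \<Omega>"
        using component_closure_meets_frontier[OF open_\<Omega> _ _ _ 1(2)] 1(1) \<A>(2,3) unfolding \<B>_def by blast
      obtain f where f: "f \<in> X" "filterlim f at_infinity (at \<zeta> within \<Omega>)"
        using sing'[OF \<zeta>(3)] by blast
      have E: "E \<subseteq> \<Omega>" using in_components_subset[OF 1(2)] by blast
      have "\<zeta> \<notin> E" using E \<zeta>(3) open_\<Omega> by (auto simp: frontier_def interior_open)
      then have "\<not> bounded (f ` E)" using blow_up_imp_unbounded[OF f(2) E \<zeta>(1)] by blast
      then show ?thesis using f(1) 1(3) by (auto simp: bounded_image_iff_nat tame_def)
    next
      case 2
      \<comment> \<open>Any frontier point in \<open>B\<close> will do: a ball around it lies in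
        \<open>B\<close>, and the singular function fails \<open>OLq q\<close> already on that
        ball.\<close>
      obtain \<zeta> where \<zeta>: "\<zeta> \<in> B" "\<zeta> \<in> frontier \<Omega>" using 2(1) by (auto simp: \<B>_def)
      obtain \<epsilon> where \<epsilon>: "\<epsilon> > 0" "ball \<zeta> \<epsilon> \<subseteq> B"
        using \<A>(2) 2(1) \<zeta>(1) open_contains_ball unfolding \<B>_def by blast
      obtain f where f: "f \<in> X" "\<forall>\<epsilon>>0. \<not> OLq q (ball \<zeta> \<epsilon> \<inter> \<Omega>) f"
        using sing'[OF \<zeta>(2)] by blast
      have "\<not> OLq q (B \<inter> \<Omega>) f"
      proof
        assume "OLq q (B \<inter> \<Omega>) f"
        then have "OLq q (ball \<zeta> \<epsilon> \<inter> \<Omega>) f" by (rule OLq_subset) (use \<epsilon>(2) in blast)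
        then show False using f(2) \<epsilon>(1) by blast
      qed
      then show ?thesis using OLq_iff_tame[OF f(1)] f(1) 2(2) by blast
    qed
  qed
  then obtain f where f: "\<And>i. i \<in> I \<Longrightarrow> f i \<in> X" "\<And>i M. i \<in> I \<Longrightarrow> f i \<notin> tame i M" by metis
  have clo: "AE_closed (tame i M)" if "i \<in> I" for i M
    using AE_closed_tame[of "snd i" "fst i" M] I_props[OF that] by simp
  have esc: "(\<lambda>z. g z + s * f i z) \<notin> tame i M'" if "i \<in> I" "g \<in> tame i M" "s \<noteq> 0" for i g s M M'
    using tame_escape[of "snd i" "fst i" "f i" g M s M'] I_props[OF that(1)] f that by simp
  have "g \<in> R \<longleftrightarrow> (\<forall>i\<in>I. \<forall>M. g \<notin> tame i M)" if g: "g \<in> X" for g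
  proof -
    have "totally_unbounded g \<Omega> \<longleftrightarrow> (\<forall>B\<in>\<B>. \<forall>E\<in>components (B \<inter> \<Omega>). \<not> bounded (g ` E))"
      unfolding \<B>_def using totally_unbounded_iff_base[OF \<A>(2-4)] by blast
    also have "\<dots> \<longleftrightarrow> (\<forall>B\<in>\<B>. \<forall>E\<in>components (B \<inter> \<Omega>). \<forall>M. g \<notin> tame (True, E) M)"
      using g by (simp add: bounded_image_iff_nat tame_def)
    finally have tu: "totally_unbounded g \<Omega> \<longleftrightarrow> \<dots>" .
    have "(\<forall>\<zeta>\<in>frontier \<Omega>. \<forall>\<epsilon>>0. \<not> OLq q (ball \<zeta> \<epsilon> \<inter> \<Omega>) g) \<longleftrightarrow> (\<forall>B\<in>\<B>. \<not> OLq q (B \<inter> \<Omega>) g)"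
      unfolding \<B>_def using nowhere_OLq_iff_base[OF \<A>(2,4)] by blast
    also have "\<dots> \<longleftrightarrow> (\<forall>B\<in>\<B>. \<forall>M. g \<notin> tame (q = \<infinity>, B \<inter> \<Omega>) M)"
      using OLq_iff_tame[OF g] by simp
    finally show ?thesis
      unfolding R_def I_def using tu g by (simp add: ball_Un)
  qed
  then have "R = {g \<in> X. \<forall>i\<in>I. \<forall>M. g \<notin> tame i M}"
    unfolding R_def by blast
  then show ?thesis
    using dense_avoiding[OF I clo f(1) esc] gdelta_avoiding[OF I clo] by simp
qed

end

theorem theorem8:
  fixes \<Omega> :: "(complex^'n) set" and q :: ereal and pj :: "nat \<Rightarrow> real"
  assumes "bounded \<Omega>" and "open \<Omega>"
    and "1 < q"
    and "strict_mono pj" and "1 < pj 0" and "\<And>j. ereal (pj j) < q"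
    and "(\<lambda>j. ereal (pj j)) \<longlonglongrightarrow> q"
    and "\<forall>\<zeta>\<in>frontier \<Omega>. \<exists>f. OL_below q \<Omega> f
           \<and> (\<forall>\<epsilon>>0. \<not> OLq q (ball \<zeta> \<epsilon> \<inter> \<Omega>) f)
           \<and> filterlim f at_infinity (at \<zeta> within \<Omega>)"
  shows "Metric_space.mtopology (OL_space q \<Omega>) (OL_dist pj \<Omega>) closure_of
           {g \<in> OL_space q \<Omega>. totally_unbounded g \<Omega>
              \<and> (\<forall>\<zeta>\<in>frontier \<Omega>. \<forall>\<epsilon>>0. \<not> OLq q (ball \<zeta> \<epsilon> \<inter> \<Omega>) g)}
         = OL_space q \<Omega>
       \<and> gdelta_in (Metric_space.mtopology (OL_space q \<Omega>) (OL_dist pj \<Omega>))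
           {g \<in> OL_space q \<Omega>. totally_unbounded g \<Omega>
              \<and> (\<forall>\<zeta>\<in>frontier \<Omega>. \<forall>\<epsilon>>0. \<not> OLq q (ball \<zeta> \<epsilon> \<inter> \<Omega>) g)}"
proof -
  interpret OL_setting \<Omega> q pj
    using assms(1-7) by unfold_locales
  show ?thesis using assms(8) by (rule dense_gdelta)
qed

end
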